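(* Let $n\ge1$, $N=2^n$, $M=4$. Let $p,q,r,s\in\mathbb{Z}_N$, let $c\in\mathbb{Z}_4$ be odd, and let $$Z=\begin{pmatrix}1+p&q\\ q&1+p\end{pmatrix},\quad J=\begin{pmatrix}0&1\\1&0\end{pmatrix},\quad \sigma=1+p+q,\quad \mu=1+p-q .$$ Let $G$ be the group defined by the presentation $$G=\left\langle a,b,t,z \;\middle|\; \begin{array}{l} a^N=b^N=t^2=z^4=1,\ [a,b]=1,\\ a^t=b,\ b^t=a,\\ a^z=a^{1+p}b^{q},\ b^z=a^{q}b^{1+p},\\ t^z=t\,z^{2c}a^{r}b^{s}\end{array}\right\rangle ,$$ and put $H=\langle a,b,t\rangle$, $K=\langle z\rangle$, $B=\langle a,b\rangle$ (subgroups of $G$). Then $G=HK$ is a non-split exact product with $H\cong\mathrm{W}_{2^n}$, $K\cong C_4$ and $B$ normal in $G$ if and only if 1. $Z^2\equiv I\pmod N$; 2. $(Z-J)\binom rs\equiv\binom00\pmod N$; 3. $(I+Z)\binom rs\equiv\binom00\pmod{N/2}$. Moreover, condition 1 is equivalent to $$\sigma^2+\mu^2\equiv2\pmod{2N}\quad\text{and}\quad\sigma^2\equiv\mu^2\pmod{2N},$$ and this is strictly stronger than the condition $\sigma^4\equiv\mu^4\equiv1\pmod N$ (that is, it implies the latter, but the converse implication fails in general).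
   Context: All groups are finite; $g^h=h^{-1}gh$, $[g,h]=g^{-1}h^{-1}gh$; $\mathbb{Z}_N=\mathbb{Z}/N\mathbb{Z}$. The wreathed $2$-group is $\mathrm{W}_{2^n}=C_{2^n}\wr C_2=\langle a,b,t\mid a^N=b^N=t^2=1,\ [a,b]=1,\ a^t=b,\ b^t=a\rangle$, of order $2N^2$, with base $\langle a\rangle\times\langle b\rangle\cong(\mathbb{Z}_N)^2$. A product $G=HK$ of subgroups is exact if $H\cap K=\{1\}$. The exact product $G=HK$ is called split if $H$ is normal in $G$ (so $G=H\rtimes K$), and non-split otherwise. In the congruences modulo $2N$, $\sigma$ and $\mu$ are replaced by arbitrary integer representatives of their classes modulo $N$; the residues of $\sigma^2,\mu^2$ modulo $2N$ do not depend on the choice since $N$ is even. *)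

theory Defs
  imports
    "HOL-Algebra.Algebra"
    "HOL-Analysis.Cartesian_Space"
    "HOL-Number_Theory.Cong"
begin

text \<open>
  A word is a list of letters; the letter \<open>(x, True)\<close> stands for the generator \<open>x\<close> and
  \<open>(x, False)\<close> for its formal inverse.  The set of generators is the whole type \<open>'g\<close>.
  A relation \<open>u = v\<close> is encoded as the pair \<open>(u, v)\<close>.
\<close>

type_synonym 'g word = "('g \<times> bool) list"

definition wgen :: "'g \<Rightarrow> 'g word" where
  "wgen x = [(x, True)]"

definition winv :: "'g word \<Rightarrow> 'g word" where
  "winv u = rev (map (\<lambda>(x, e). (x, \<not> e)) u)"

definition wpow :: "'g word \<Rightarrow> int \<Rightarrow> 'g word" where
  "wpow u k = (if k \<ge> 0 then concat (replicate (nat k) u)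
                        else concat (replicate (nat (- k)) (winv u)))"

definition wconj :: "'g word \<Rightarrow> 'g word \<Rightarrow> 'g word" where
  "wconj g h = winv h @ g @ h"

definition wcomm :: "'g word \<Rightarrow> 'g word \<Rightarrow> 'g word" where
  "wcomm g h = winv g @ winv h @ g @ h"

text \<open>
  Equality of words in the presented group: the least congruence on words that contains the
  free cancellations and the relations \<open>R\<close>.
\<close>

inductive word_eq :: "('g word \<times> 'g word) set \<Rightarrow> 'g word \<Rightarrow> 'g word \<Rightarrow> bool"
  for R :: "('g word \<times> 'g word) set" where
  refl: "word_eq R u u"
| sym: "word_eq R u v \<Longrightarrow> word_eq R v u"
| trans: "word_eq R u v \<Longrightarrow> word_eq R v w \<Longrightarrow> word_eq R u w"
| cancel: "word_eq R (u @ [(x, e), (x, \<not> e)] @ v) (u @ v)"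
| rel: "(l, r) \<in> R \<Longrightarrow> word_eq R (u @ l @ v) (u @ r @ v)"

definition word_class :: "('g word \<times> 'g word) set \<Rightarrow> 'g word \<Rightarrow> 'g word set" where
  "word_class R u = {v. word_eq R u v}"

definition presented_group :: "('g word \<times> 'g word) set \<Rightarrow> 'g word set monoid" where
  "presented_group R =
     \<lparr> carrier = range (word_class R),
       monoid.mult = (\<lambda>A B. \<Union>u\<in>A. \<Union>v\<in>B. word_class R (u @ v)),
       one = word_class R [] \<rparr>"

lemma word_class_eq_iff: "word_class R u = word_class R v \<longleftrightarrow> word_eq R u v"
proof
  assume "word_class R u = word_class R v"
  moreover have "v \<in> word_class R v" by (simp add: word_class_def word_eq.refl)
  ultimately have "v \<in> word_class R u" by simp
  then show "word_eq R u v" by (simp add: word_class_def)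
next
  assume uv: "word_eq R u v"
  have "word_eq R u w \<longleftrightarrow> word_eq R v w" for w
    using uv word_eq.trans[of R u v w] word_eq.trans[of R v u w] word_eq.sym[of R u v] by blast
  then show "word_class R u = word_class R v"
    by (simp add: word_class_def)
qed

lemma word_eq_append_left: "word_eq R u v \<Longrightarrow> word_eq R (w @ u) (w @ v)"
proof (induction rule: word_eq.induct)
  case (cancel u x e v)
  show ?case using word_eq.cancel[of R "w @ u" x e v] by simp
next
  case (rel l r u v)
  show ?case using word_eq.rel[OF rel, of "w @ u" v] by simp
qed (rule word_eq.refl, erule word_eq.sym, erule word_eq.trans, assumption)

lemma word_eq_append_right: "word_eq R u v \<Longrightarrow> word_eq R (u @ w) (v @ w)"
proof (induction rule: word_eq.induct)
  case (cancel u x e v)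
  show ?case using word_eq.cancel[of R u x e "v @ w"] by simp
next
  case (rel l r u v)
  show ?case using word_eq.rel[OF rel, of u "v @ w"] by simp
qed (rule word_eq.refl, erule word_eq.sym, erule word_eq.trans, assumption)

lemma word_eq_append:
  "word_eq R u u' \<Longrightarrow> word_eq R v v' \<Longrightarrow> word_eq R (u @ v) (u' @ v')"
  by (rule word_eq.trans[OF word_eq_append_right word_eq_append_left])

lemma word_class_mult:
  "word_class R u \<otimes>\<^bsub>presented_group R\<^esub> word_class R v = word_class R (u @ v)"
proof -
  have *: "word_class R (u' @ v') = word_class R (u @ v)"
    if "u' \<in> word_class R u" "v' \<in> word_class R v" for u' v'
  proof -
    have "word_eq R u u'" "word_eq R v v'"
      using that by (simp_all add: word_class_def)
    then show ?thesis
      unfolding word_class_eq_iff by (rule word_eq.sym[OF word_eq_append])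
  qed
  have self: "u \<in> word_class R u" "v \<in> word_class R v"
    by (simp_all add: word_class_def word_eq.refl)
  have "(\<Union>u'\<in>word_class R u. \<Union>v'\<in>word_class R v. word_class R (u' @ v'))
      = (\<Union>u'\<in>word_class R u. \<Union>v'\<in>word_class R v. word_class R (u @ v))"
    by (intro SUP_cong HOL.refl *)
  also have "\<dots> = word_class R (u @ v)"
    using self by blast
  finally show ?thesis
    by (simp add: presented_group_def)
qed

lemma word_eq_winv: "word_eq R (winv u @ u) []"
proof (induction u)
  case Nil
  show ?case by (simp add: winv_def word_eq.refl)
next
  case (Cons l u)
  obtain x e where l: "l = (x, e)" by fastforce
  have eq: "winv (l # u) @ l # u = winv u @ [(x, \<not> e), (x, \<not> \<not> e)] @ u"
    by (simp add: winv_def l)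
  have "word_eq R (winv (l # u) @ l # u) (winv u @ u)"
    unfolding eq by (rule word_eq.cancel)
  with Cons.IH show ?case by (rule word_eq.trans[rotated])
qed

lemma group_presented_group: "group (presented_group R)"
proof (rule groupI)
  show "\<one>\<^bsub>presented_group R\<^esub> \<in> carrier (presented_group R)"
    by (simp add: presented_group_def)
next
  fix x assume "x \<in> carrier (presented_group R)"
  then obtain u where u: "x = word_class R u" by (auto simp: presented_group_def)
  have one: "\<one>\<^bsub>presented_group R\<^esub> = word_class R []"
    by (simp add: presented_group_def)
  show "\<one>\<^bsub>presented_group R\<^esub> \<otimes>\<^bsub>presented_group R\<^esub> x = x"
    by (simp add: one u word_class_mult)
  show "\<exists>y\<in>carrier (presented_group R). y \<otimes>\<^bsub>presented_group R\<^esub> x = \<one>\<^bsub>presented_group R\<^esub>"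
  proof
    show "word_class R (winv u) \<otimes>\<^bsub>presented_group R\<^esub> x = \<one>\<^bsub>presented_group R\<^esub>"
      by (simp add: one u word_class_mult word_class_eq_iff word_eq_winv)
    show "word_class R (winv u) \<in> carrier (presented_group R)"
      by (simp add: presented_group_def)
  qed
next
  fix x y assume "x \<in> carrier (presented_group R)" "y \<in> carrier (presented_group R)"
  then obtain u v where "x = word_class R u" "y = word_class R v"
    by (auto simp: presented_group_def)
  then show "x \<otimes>\<^bsub>presented_group R\<^esub> y \<in> carrier (presented_group R)"
    by (simp add: word_class_mult) (simp add: presented_group_def)
next
  fix x y z assume "x \<in> carrier (presented_group R)" "y \<in> carrier (presented_group R)"
    "z \<in> carrier (presented_group R)"
  then obtain u v w where "x = word_class R u" "y = word_class R v" "z = word_class R w"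
    by (auto simp: presented_group_def)
  then show "x \<otimes>\<^bsub>presented_group R\<^esub> y \<otimes>\<^bsub>presented_group R\<^esub> z
      = x \<otimes>\<^bsub>presented_group R\<^esub> (y \<otimes>\<^bsub>presented_group R\<^esub> z)"
    by (simp add: word_class_mult)
qed

datatype wreathed_gen = Wa | Wb | Wt

definition wreathed_relations :: "nat \<Rightarrow> (wreathed_gen word \<times> wreathed_gen word) set" where
  "wreathed_relations n =
    (let N = 2 ^ n; a = wgen Wa; b = wgen Wb; t = wgen Wt in
     { (wpow a N, []), (wpow b N, []), (wpow t 2, []),
       (wcomm a b, []),
       (wconj a t, b), (wconj b t, a) })"

definition wreathed_group :: "nat \<Rightarrow> wreathed_gen word set monoid" where
  "wreathed_group n = presented_group (wreathed_relations n)"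

datatype gen = Ga | Gb | Gt | Gz

text \<open>
  The parameters \<open>p, q, r, s\<close> (classes modulo \<open>2 ^ n\<close>) and \<open>c\<close> (a class modulo 4) are given by
  integer representatives; since \<open>a\<close>, \<open>b\<close> have order dividing \<open>2 ^ n\<close> and \<open>z\<close> has order dividing 4,
  the presented group does not depend on the choice.
\<close>

definition G_relations ::
  "nat \<Rightarrow> int \<Rightarrow> int \<Rightarrow> int \<Rightarrow> int \<Rightarrow> int \<Rightarrow> (gen word \<times> gen word) set" where
  "G_relations n p q r s c =
    (let N = 2 ^ n; a = wgen Ga; b = wgen Gb; t = wgen Gt; z = wgen Gz in
     { (wpow a N, []), (wpow b N, []), (wpow t 2, []), (wpow z 4, []),
       (wcomm a b, []),
       (wconj a t, b), (wconj b t, a),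
       (wconj a z, wpow a (1 + p) @ wpow b q),
       (wconj b z, wpow a q @ wpow b (1 + p)),
       (wconj t z, t @ wpow z (2 * c) @ wpow a r @ wpow b s) })"

definition G_group :: "nat \<Rightarrow> int \<Rightarrow> int \<Rightarrow> int \<Rightarrow> int \<Rightarrow> int \<Rightarrow> gen word set monoid" where
  "G_group n p q r s c = presented_group (G_relations n p q r s c)"

definition G_gen :: "nat \<Rightarrow> int \<Rightarrow> int \<Rightarrow> int \<Rightarrow> int \<Rightarrow> int \<Rightarrow> gen \<Rightarrow> gen word set" where
  "G_gen n p q r s c x = word_class (G_relations n p q r s c) (wgen x)"

definition exact_product :: "('a, 'm) monoid_scheme \<Rightarrow> 'a set \<Rightarrow> 'a set \<Rightarrow> bool" where
  "exact_product G H K \<longleftrightarrow>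
     group G \<and> subgroup H G \<and> subgroup K G \<and>
     carrier G = H <#>\<^bsub>G\<^esub> K \<and> H \<inter> K = {\<one>\<^bsub>G\<^esub>}"

definition split_exact_product :: "('a, 'm) monoid_scheme \<Rightarrow> 'a set \<Rightarrow> 'a set \<Rightarrow> bool" where
  "split_exact_product G H K \<longleftrightarrow> exact_product G H K \<and> H \<lhd> G"

definition nonsplit_exact_product :: "('a, 'm) monoid_scheme \<Rightarrow> 'a set \<Rightarrow> 'a set \<Rightarrow> bool" where
  "nonsplit_exact_product G H K \<longleftrightarrow> exact_product G H K \<and> \<not> split_exact_product G H K"

definition vec_cong :: "int ^ 'n \<Rightarrow> int ^ 'n \<Rightarrow> int \<Rightarrow> bool" where
  "vec_cong v w m \<longleftrightarrow> (\<forall>i. [v $ i = w $ i] (mod m))"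

definition mat_cong :: "int ^ 'n ^ 'k \<Rightarrow> int ^ 'n ^ 'k \<Rightarrow> int \<Rightarrow> bool" where
  "mat_cong A B m \<longleftrightarrow> (\<forall>i j. [A $ i $ j = B $ i $ j] (mod m))"

definition Z_mat :: "int \<Rightarrow> int \<Rightarrow> int ^ 2 ^ 2" where
  "Z_mat p q = vector [vector [1 + p, q], vector [q, 1 + p]]"

definition J_mat :: "int ^ 2 ^ 2" where
  "J_mat = vector [vector [0, 1], vector [1, 0]]"

end

theory Submission
  imports Defs
begin

text \<open>
  Write \<open>v = (r, s)\<close> and let \<open>J\<close> swap coordinates.  Throughout, \<open>a ^ x b ^ y\<close> is identified with the
  vector \<open>(x, y)\<close>, on which conjugation by \<open>t\<close> acts as \<open>J\<close> and conjugation by \<open>z\<close> as the circulant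
  matrix \<open>Z\<close>; as \<open>c\<close> is odd and \<open>z ^ 4 = 1\<close>, the last relation reads \<open>t ^ z = t z ^ 2 v\<close>.

  \<^emph>\<open>Necessity.\<close>  Comparing how both sides of the last relation act on \<open>B\<close> gives \<open>J = J Z\<^sup>2\<close>, so \<open>Z\<^sup>2\<close>
  fixes \<open>B\<close> pointwise (\<open>\<gamma>_Z_Z\<close>).  The relation then takes the form \<open>z ^ t = z ^ {-1} (-v)\<close> (\<open>z_t\<close>).
  Conjugating twice by \<open>t\<close> must return \<open>z\<close>, which forces \<open>Z v = J v\<close> in \<open>B\<close> (\<open>\<gamma>_Z_v\<close>), and the fourth
  power of \<open>z ^ t\<close> must be trivial, which forces \<open>2 (I + Z) v = 0\<close> in \<open>B\<close> (\<open>\<gamma>_2_v_Z_v\<close>).  These are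
  congruences modulo \<open>N\<close> as soon as \<open>B\<close> is a full copy of \<open>(\<int> / N)\<^sup>2\<close>.  That follows from
  \<open>H \<cong> W\<close>: the canonical surjection from the wreathed group \<open>W\<close> onto \<open>H\<close> is a surjection between
  finite sets of the same size (\<open>faithful_if_wreathed\<close>).

  \<^emph>\<open>Sufficiency.\<close>  The three conditions say precisely that \<open>z \<mapsto> z ^ {-1} (-v)\<close>, \<open>w \<mapsto> J w\<close> defines an
  automorphism of order two of the semidirect product \<open>L = (\<int> / N)\<^sup>2 \<rtimes> C\<^sub>4\<close>, so that
  \<open>L \<rtimes> C\<^sub>2\<close> is a group of order \<open>8 N\<^sup>2\<close> satisfying the relations.  It acts faithfully on the set
  \<open>L\<close>: elements of \<open>L\<close> by right translation, \<open>t\<close> by the automorphism.  Checking the relations on this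
  action (\<open>fold_act_relation\<close>) shows that no two normal forms collapse in \<open>G\<close>
  (\<open>normal_forms_distinct\<close>), hence \<open>H \<cong> W\<close>, \<open>K \<cong> C\<^sub>4\<close> and \<open>H \<inter> K = {1}\<close>.  Every element of \<open>G\<close> lies in
  \<open>H K\<close>, since \<open>t\<close> normalizes the subgroup \<open>B K\<close> (\<open>carrier_eq_H_K\<close>).  The product is not split, because \<open>t ^ z \<in> H\<close> would put \<open>z ^ 2\<close> into \<open>H\<close>.

  The case \<open>Z = I\<close>, \<open>v = 0\<close> satisfies the conditions for every \<open>N\<close>; mapping \<open>W\<close> into that group shows
  that \<open>W\<close> itself has the expected normal forms (\<open>wreathed_base_faithful\<close>).

  The reformulation of \<open>Z\<^sup>2 = I\<close> holds because \<open>\<sigma>\<close> and \<open>\<mu>\<close> are the eigenvalues of \<open>Z\<close>: the sum and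
  the difference of their squares are twice the diagonal and twice the off-diagonal entry of \<open>Z\<^sup>2\<close>,
  and this factor two accounts for the modulus \<open>2 N\<close>.
\<close>

section \<open>Evaluating words in a group\<close>

lemma carrier_presented_group: "carrier (presented_group R) = range (word_class R)"
  by (simp add: presented_group_def)

lemma one_presented_group: "\<one>\<^bsub>presented_group R\<^esub> = word_class R []"
  by (simp add: presented_group_def)

primrec weval :: "('a, 'm) monoid_scheme \<Rightarrow> ('g \<Rightarrow> 'a) \<Rightarrow> 'g word \<Rightarrow> 'a" where
  "weval G f [] = \<one>\<^bsub>G\<^esub>"
| "weval G f (l # u) =
     (if snd l then f (fst l) else inv\<^bsub>G\<^esub> f (fst l)) \<otimes>\<^bsub>G\<^esub> weval G f u"

locale word_valuation = group G for G (structure) +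
  fixes f :: "'g \<Rightarrow> 'a"
  assumes f_closed [simp, intro]: "f x \<in> carrier G"
begin

abbreviation val :: "'g word \<Rightarrow> 'a" where "val \<equiv> weval G f"

lemma val_closed [simp, intro]: "val u \<in> carrier G"
  by (induction u) auto

lemma val_append: "val (u @ v) = val u \<otimes> val v"
  by (induction u) (auto simp: m_assoc)

lemma val_wgen: "val (wgen x) = f x"
  by (simp add: wgen_def)

lemma val_winv: "val (winv u) = inv (val u)"
proof (induction u)
  case Nil
  show ?case by (simp add: winv_def)
next
  case (Cons l u)
  have "winv (l # u) = winv u @ [(fst l, \<not> snd l)]"
    by (simp add: winv_def case_prod_beta)
  with Cons.IH show ?case
    by (simp add: val_append inv_mult_group)
qed

lemma val_replicate: "val (concat (replicate k u)) = val u [^] k"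
proof (induction k)
  case (Suc k)
  then show ?case
    using nat_pow_Suc2[of "val u" k] by (simp add: val_append)
qed simp

lemma val_wpow: "val (wpow u k) = val u [^] k"
proof (cases "k \<ge> 0")
  case True
  then show ?thesis by (simp add: wpow_def val_replicate)
next
  case False
  then show ?thesis
    by (simp add: wpow_def val_replicate val_winv int_pow_def2[of _ "val u"] nat_pow_inv del: pow_nat)
qed

lemma val_wconj: "val (wconj u v) = inv (val v) \<otimes> (val u \<otimes> val v)"
  by (simp add: wconj_def val_append val_winv)

lemma val_wcomm: "val (wcomm u v) = inv (val u) \<otimes> (inv (val v) \<otimes> (val u \<otimes> val v))"
  by (simp add: wcomm_def val_append val_winv)

lemmas val_simps = val_append val_wgen val_wpow val_wconj val_wcomm

lemma val_in_generate: "val u \<in> generate G (range f)"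
proof (induction u)
  case (Cons l u)
  have "(if snd l then f (fst l) else inv f (fst l)) \<in> generate G (range f)"
    by (simp add: generate.incl generate.inv)
  with Cons.IH show ?case
    by (simp add: generate.eng)
qed (simp add: generate.one)

lemma val_respects_word_eq:
  assumes "word_eq R u v" and R: "\<And>l r. (l, r) \<in> R \<Longrightarrow> val l = val r"
  shows "val u = val v"
  using assms(1)
proof (induction rule: word_eq.induct)
  case (cancel u x e v)
  show ?case
    by (cases e) (simp_all add: val_append m_assoc[symmetric])
next
  case (rel l r u v)
  show ?case by (simp add: val_append R[OF rel])
qed simp_all

text \<open>
  Von Dyck's theorem: a valuation of the generators that respects the relations extends to the
  presented group.  It yields the maps out of the wreathed group.
\<close>

lemma von_Dyck:
  assumes R: "\<And>l r. (l, r) \<in> R \<Longrightarrow> val l = val r"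
  obtains h where "h \<in> hom (presented_group R) G"
    and "\<And>u. h (word_class R u) = val u"
proof -
  define h where "h A = val (SOME u. A = word_class R u)" for A
  have h: "h (word_class R u) = val u" for u
  proof -
    have "word_class R u = word_class R (SOME v. word_class R u = word_class R v)"
      by (rule someI[of _ u]) (rule HOL.refl)
    then have "word_eq R u (SOME v. word_class R u = word_class R v)"
      by (simp only: word_class_eq_iff)
    then have "val u = val (SOME v. word_class R u = word_class R v)"
      by (rule val_respects_word_eq[OF _ R])
    then show ?thesis by (simp only: h_def)
  qed
  have "h \<in> hom (presented_group R) G"
  proof (rule homI)
    fix A B
    assume "A \<in> carrier (presented_group R)" "B \<in> carrier (presented_group R)"
    then show "h (A \<otimes>\<^bsub>presented_group R\<^esub> B) = h A \<otimes> h B"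
      by (auto simp: carrier_presented_group h word_class_mult val_append)
  qed (auto simp: carrier_presented_group h)
  then show ?thesis by (rule that[OF _ h])
qed

end

abbreviation pgen :: "('g word \<times> 'g word) set \<Rightarrow> 'g \<Rightarrow> 'g word set" where
  "pgen R x \<equiv> word_class R (wgen x)"

lemma word_valuation_presented: "word_valuation (presented_group R) (pgen R)"
  by (intro word_valuation.intro group_presented_group word_valuation_axioms.intro)
     (simp add: carrier_presented_group)

lemma weval_presented: "weval (presented_group R) (pgen R) u = word_class R u"
proof -
  interpret word_valuation "presented_group R" "pgen R"
    by (rule word_valuation_presented)
  have inv: "inv\<^bsub>presented_group R\<^esub> word_class R w = word_class R (winv w)" for w
  proof (rule inv_equality)
    show "word_class R (winv w) \<otimes>\<^bsub>presented_group R\<^esub> word_class R w = \<one>\<^bsub>presented_group R\<^esub>"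
      by (simp add: word_class_mult one_presented_group word_class_eq_iff word_eq_winv)
  qed (simp_all add: carrier_presented_group)
  show ?thesis
  proof (induction u)
    case Nil
    show ?case by (simp add: one_presented_group)
  next
    case (Cons l u)
    then show ?case
      by (cases l; cases "snd l") (simp_all add: inv word_class_mult wgen_def winv_def)
  qed
qed

lemma presented_relation:
  "(l, r) \<in> R \<Longrightarrow> weval (presented_group R) (pgen R) l = weval (presented_group R) (pgen R) r"
  using word_eq.rel[of l r R "[]" "[]"] by (simp add: weval_presented word_class_eq_iff)

lemma generate_presented: "generate (presented_group R) (range (pgen R)) = carrier (presented_group R)"
proof -
  interpret word_valuation "presented_group R" "pgen R"
    by (rule word_valuation_presented)
  show ?thesis
  proof
    show "generate (presented_group R) (range (pgen R)) \<subseteq> carrier (presented_group R)"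
      by (rule generate_incl) auto
    show "carrier (presented_group R) \<subseteq> generate (presented_group R) (range (pgen R))"
      using val_in_generate unfolding weval_presented carrier_presented_group by blast
  qed
qed

section \<open>Groups generated by a wreathed triple\<close>

context group
begin

text \<open>
  The rewriting form of the fact that conjugation by \<open>g\<close> commutes with powers.  In this form every
  conjugation relation becomes a rule that moves \<open>g\<close> to the left through a power.
\<close>
lemma int_pow_intertwine:
  fixes k :: int
  assumes "x \<in> carrier G" "y \<in> carrier G" "g \<in> carrier G" and xg: "x \<otimes> g = g \<otimes> y"
  shows "x [^] k \<otimes> g = g \<otimes> y [^] k"
proof -
  have nat: "x [^] j \<otimes> g = g \<otimes> y [^] j" for j :: nat
  proof (induction j)
    case (Suc j)
    have "x [^] Suc j \<otimes> g = x [^] j \<otimes> g \<otimes> y"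
      using assms by (simp add: m_assoc)
    also have "\<dots> = g \<otimes> y [^] Suc j"
      using assms by (simp add: Suc m_assoc)
    finally show ?case .
  qed (use assms in simp)
  show ?thesis
  proof (cases "k \<ge> 0")
    case True
    then show ?thesis using nat[of "nat k"] by simp
  next
    case False
    define g1 g2 where "g1 = x [^] nat (- k)" and "g2 = y [^] nat (- k)"
    have cl: "g1 \<in> carrier G" "g2 \<in> carrier G"
      using assms by (simp_all add: g1_def g2_def del: pow_nat)
    have "g1 \<otimes> g = g \<otimes> g2" unfolding g1_def g2_def by (rule nat)
    then have "g = g1 \<otimes> (g \<otimes> inv g2)"
      using cl assms by (simp add: m_assoc[symmetric] inv_solve_right)
    then have "inv g1 \<otimes> g = g \<otimes> inv g2"
      using cl assms by (simp add: inv_solve_left')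
    with False show ?thesis
      by (simp add: int_pow_def2[of _ x] int_pow_def2[of _ y] g1_def g2_def del: pow_nat)
  qed
qed

lemma int_pow_cong:
  fixes j k m :: int
  assumes g: "g \<in> carrier G" "g [^] m = \<one>" and jk: "[j = k] (mod m)"
  shows "g [^] j = g [^] k"
proof -
  obtain i where "j = k + m * i"
    using jk by (metis cong_iff_lin cong_sym)
  then show ?thesis
    using g int_pow_mult[OF g(1), of k "m * i"] by (simp add: int_pow_pow[symmetric])
qed

end

text \<open>
  Only the relations of the wreathed group are required; \<open>a\<close>, \<open>b\<close> and \<open>t\<close> may satisfy further ones,
  so \<open>\<beta>\<close> below need not be injective modulo \<open>N\<close>.
\<close>
locale wreathed_triple = group G for G (structure) +
  fixes a b t :: 'a and N :: int
  assumes closed [simp, intro]: "a \<in> carrier G" "b \<in> carrier G" "t \<in> carrier G"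
    and a_pow_N: "a [^] N = \<one>" and b_pow_N: "b [^] N = \<one>" and t_t: "t \<otimes> t = \<one>"
    and a_b: "a \<otimes> b = b \<otimes> a" and a_t: "a \<otimes> t = t \<otimes> b" and b_t: "b \<otimes> t = t \<otimes> a"
begin

definition \<beta> :: "int \<Rightarrow> int \<Rightarrow> 'a" where "\<beta> x y = a [^] x \<otimes> b [^] y"

lemma \<beta>_closed [simp, intro]: "\<beta> x y \<in> carrier G"
  by (simp add: \<beta>_def)

lemma pow_commute: "b [^] (y::int) \<otimes> a [^] (x::int) = a [^] x \<otimes> b [^] y"
  by (rule int_pow_intertwine) (simp_all add: int_pow_intertwine[OF _ _ _ a_b])

lemma \<beta>_mult: "\<beta> x y \<otimes> \<beta> x' y' = \<beta> (x + x') (y + y')"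
proof -
  have "\<beta> x y \<otimes> \<beta> x' y' = a [^] x \<otimes> (b [^] y \<otimes> a [^] x') \<otimes> b [^] y'"
    by (simp add: \<beta>_def m_assoc)
  also have "\<dots> = \<beta> (x + x') (y + y')"
    unfolding pow_commute by (simp add: \<beta>_def m_assoc int_pow_mult)
  finally show ?thesis .
qed

lemma \<beta>_0 [simp]: "\<beta> 0 0 = \<one>" and \<beta>_10: "\<beta> 1 0 = a" and \<beta>_01: "\<beta> 0 1 = b"
  by (simp_all add: \<beta>_def)

lemma \<beta>_inv: "inv (\<beta> x y) = \<beta> (- x) (- y)"
  by (rule inv_equality) (simp_all add: \<beta>_mult)

lemma \<beta>_cong:
  assumes "[x = x'] (mod N)" "[y = y'] (mod N)"
  shows "\<beta> x y = \<beta> x' y'"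
  unfolding \<beta>_def
  by (simp add: int_pow_cong[OF _ a_pow_N assms(1)] int_pow_cong[OF _ b_pow_N assms(2)])

lemma \<beta>_t: "\<beta> x y \<otimes> t = t \<otimes> \<beta> y x"
proof -
  have "\<beta> x y \<otimes> t = a [^] x \<otimes> (b [^] y \<otimes> t)"
    by (simp add: \<beta>_def m_assoc)
  also have "\<dots> = (a [^] x \<otimes> t) \<otimes> a [^] y"
    by (simp add: int_pow_intertwine[OF _ _ _ b_t] m_assoc)
  also have "\<dots> = t \<otimes> (b [^] x \<otimes> a [^] y)"
    by (simp add: int_pow_intertwine[OF _ _ _ a_t] m_assoc)
  finally show ?thesis by (simp add: pow_commute \<beta>_def)
qed

lemma inv_t [simp]: "inv t = t"
  by (rule inv_equality) (simp_all add: t_t)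

lemma t_t_cancel [simp]: "x \<in> carrier G \<Longrightarrow> t \<otimes> (t \<otimes> x) = x"
  by (simp add: m_assoc[symmetric] t_t)

lemma \<beta>_in_subgroup:
  assumes "subgroup S G" "a \<in> S" "b \<in> S"
  shows "\<beta> x y \<in> S"
  unfolding \<beta>_def using assms by (simp add: subgroup_int_pow_closed subgroup.m_closed)

definition base :: "'a set" where "base = range (case_prod \<beta>)"

lemma \<beta>_in_base [simp, intro]: "\<beta> x y \<in> base"
  by (auto simp: base_def)

lemma baseE: "g \<in> base \<Longrightarrow> (\<And>x y. g = \<beta> x y \<Longrightarrow> P) \<Longrightarrow> P"
  by (auto simp: base_def)

lemma one_in_base [simp]: "\<one> \<in> base"
  by (metis \<beta>_0 \<beta>_in_base)

lemma subgroup_base: "subgroup base G"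
  by (rule subgroupI) (auto simp: \<beta>_mult \<beta>_inv elim!: baseE)

lemma generate_ab: "generate G {a, b} = base"
proof
  have "{a, b} \<subseteq> base"
    using \<beta>_in_base[of 1 0] \<beta>_in_base[of 0 1] by (simp add: \<beta>_10 \<beta>_01)
  then show "generate G {a, b} \<subseteq> base"
    by (rule generate_subgroup_incl[OF _ subgroup_base])
  show "base \<subseteq> generate G {a, b}"
    using \<beta>_in_subgroup[OF generate_is_subgroup[of "{a, b}"]] by (auto elim!: baseE intro: generate.incl)
qed

lemma generate_abt: "generate G {a, b, t} = base \<union> (\<lambda>g. t \<otimes> g) ` base"
proof
  let ?S = "base \<union> (\<lambda>g. t \<otimes> g) ` base"
  have tb: "\<beta> x y \<otimes> (t \<otimes> g) = t \<otimes> (\<beta> y x \<otimes> g)" if "g \<in> carrier G" for x y g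
    using that by (simp add: m_assoc[symmetric] \<beta>_t)
  have "subgroup ?S G"
  proof (rule subgroupI)
    fix g assume "g \<in> ?S"
    then show "inv g \<in> ?S"
      by (auto simp: \<beta>_inv inv_mult_group \<beta>_t elim!: baseE)
  next
    fix g h assume "g \<in> ?S" "h \<in> ?S"
    then show "g \<otimes> h \<in> ?S"
      by (auto simp: \<beta>_mult tb m_assoc elim!: baseE)
  qed (use subgroup.subset[OF subgroup_base] in auto)
  moreover have "a \<in> ?S" "b \<in> ?S"
    using \<beta>_in_base[of 1 0] \<beta>_in_base[of 0 1] by (simp_all add: \<beta>_10 \<beta>_01)
  moreover have "t \<in> ?S"
    using imageI[OF one_in_base, of "\<lambda>g. t \<otimes> g"] by simp
  ultimately show "generate G {a, b, t} \<subseteq> ?S"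
    by (intro generate_subgroup_incl) auto
  have S: "subgroup (generate G {a, b, t}) G" by (rule generate_is_subgroup) auto
  moreover have "t \<in> generate G {a, b, t}" by (auto intro: generate.incl)
  moreover have "\<beta> x y \<in> generate G {a, b, t}" for x y
    by (rule \<beta>_in_subgroup[OF S]) (auto intro: generate.incl)
  ultimately show "?S \<subseteq> generate G {a, b, t}"
    by (auto intro: subgroup.m_closed elim!: baseE)
qed

text \<open>
  Finiteness is what turns an abstract isomorphism with the wreathed group into injectivity of the
  canonical surjection.
\<close>
lemma finite_generate_abt:
  assumes "N > 0"
  shows "finite (generate G {a, b, t})"
proof -
  let ?D = "(\<lambda>(x, y). \<beta> x y) ` ({0..<N} \<times> {0..<N})"
  have D: "\<beta> x y \<in> ?D" for x y
  proof -
    have "\<beta> x y = \<beta> (x mod N) (y mod N)"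
      by (rule \<beta>_cong) (simp_all add: cong_def)
    then show ?thesis using assms by force
  qed
  have "generate G {a, b, t} \<subseteq> ?D \<union> (\<lambda>g. t \<otimes> g) ` ?D"
    unfolding generate_abt using D by (auto elim!: baseE)
  then show ?thesis by (rule finite_subset) auto
qed

end

section \<open>Extending a wreathed triple by an element of order four\<close>

definition circulant :: "int \<Rightarrow> int \<Rightarrow> int \<times> int \<Rightarrow> int \<times> int" where
  "circulant P q w = (P * fst w + q * snd w, q * fst w + P * snd w)"

lemma circulant_swap: "circulant P q (prod.swap w) = prod.swap (circulant P q w)"
  by (simp add: circulant_def)

text \<open>
  The relations of \<open>G\<close>, with every conjugation \<open>g ^ h = k\<close> written as \<open>g h = h k\<close>, and with \<open>z ^ (2 c)\<close>
  replaced by \<open>z ^ 2\<close>.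
\<close>
locale wreathed_extension = wreathed_triple +
  fixes z :: 'a and P q r s :: int
  assumes z_closed [simp, intro]: "z \<in> carrier G"
    and z_4: "z [^] (4::int) = \<one>"
    and a_z: "a \<otimes> z = z \<otimes> \<beta> P q"
    and b_z: "b \<otimes> z = z \<otimes> \<beta> q P"
    and t_z: "t \<otimes> z = z \<otimes> (t \<otimes> (z \<otimes> (z \<otimes> \<beta> r s)))"
begin

abbreviation \<gamma> :: "int \<times> int \<Rightarrow> 'a" where "\<gamma> w \<equiv> \<beta> (fst w) (snd w)"

abbreviation Zv :: "int \<times> int \<Rightarrow> int \<times> int" where "Zv \<equiv> circulant P q"

lemma zzzz: "z \<otimes> (z \<otimes> (z \<otimes> z)) = \<one>"
proof -
  have "z [^] (4::int) = z [^] (4::nat)"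
    using int_pow_int[of G z 4] by simp
  then show ?thesis
    using z_4 by (simp add: numeral_eq_Suc m_assoc)
qed

lemma \<beta>_pow: "\<beta> x y [^] k = \<beta> (x * k) (y * k)" for k :: int
  unfolding \<beta>_def
  by (subst int_pow_mult_distrib) (simp_all add: pow_commute int_pow_pow)

lemma \<gamma>_z: "\<gamma> w \<otimes> z = z \<otimes> \<gamma> (Zv w)"
proof -
  obtain x y where w: "w = (x, y)" by fastforce
  have "\<gamma> w \<otimes> z = a [^] x \<otimes> (b [^] y \<otimes> z)"
    by (simp add: w \<beta>_def m_assoc)
  also have "\<dots> = (a [^] x \<otimes> z) \<otimes> \<beta> (q * y) (P * y)"
    by (simp add: int_pow_intertwine[OF _ _ _ b_z] m_assoc \<beta>_pow)
  also have "\<dots> = z \<otimes> \<gamma> (Zv w)"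
    by (simp add: int_pow_intertwine[OF _ _ _ a_z] m_assoc \<beta>_pow \<beta>_mult w circulant_def)
  finally show ?thesis .
qed

lemma \<gamma>_t: "\<gamma> w \<otimes> t = t \<otimes> \<gamma> (prod.swap w)"
  by (simp add: \<beta>_t)

lemma \<gamma>_z': "g \<in> carrier G \<Longrightarrow> \<gamma> w \<otimes> (z \<otimes> g) = z \<otimes> (\<gamma> (Zv w) \<otimes> g)"
  using \<gamma>_z[of w] by (simp add: m_assoc[symmetric])

lemma \<gamma>_t': "g \<in> carrier G \<Longrightarrow> \<gamma> w \<otimes> (t \<otimes> g) = t \<otimes> (\<gamma> (prod.swap w) \<otimes> g)"
  using \<gamma>_t[of w] by (simp add: m_assoc[symmetric])

lemma \<gamma>_comm: "\<gamma> w \<otimes> \<gamma> u = \<gamma> u \<otimes> \<gamma> w"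
  by (simp add: \<beta>_mult add.commute)

text \<open>
  Both \<open>t z\<close> and \<open>z t z\<^sup>2 v\<close> act on \<open>B\<close> by conjugation, the first as \<open>Z J\<close>, the second as \<open>Z\<^sup>3 J\<close>, because
  \<open>v\<close> acts trivially and \<open>Z\<close> commutes with \<open>J\<close>.  So \<open>Z\<^sup>3 = Z\<close> on \<open>B\<close>, and \<open>Z\<^sup>4 = 1\<close> by \<open>z ^ 4 = 1\<close>.
\<close>
lemma \<gamma>_Z_Z: "\<gamma> (Zv (Zv w)) = \<gamma> w"
proof -
  have cube: "\<gamma> (Zv (Zv (Zv u))) = \<gamma> (Zv u)" for u
  proof -
    let ?u = "prod.swap u"
    have "\<gamma> ?u \<otimes> (t \<otimes> z) = t \<otimes> (z \<otimes> \<gamma> (Zv u))"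
      by (simp only: \<gamma>_t' \<gamma>_z z_closed swap_swap)
    also have "\<dots> = (t \<otimes> z) \<otimes> \<gamma> (Zv u)"
      by (simp add: m_assoc)
    also have "\<dots> = z \<otimes> (t \<otimes> (z \<otimes> (z \<otimes> (\<beta> r s \<otimes> \<gamma> (Zv u)))))"
      by (simp add: t_z m_assoc)
    finally have 1: "\<gamma> ?u \<otimes> (t \<otimes> z) = \<dots>" .
    have "\<gamma> ?u \<otimes> (t \<otimes> z) = z \<otimes> (t \<otimes> (z \<otimes> (z \<otimes> (\<gamma> (Zv (Zv (Zv u))) \<otimes> \<beta> r s))))"
      unfolding t_z
      by (simp only: \<gamma>_t' \<gamma>_z' circulant_swap swap_swap z_closed closed \<beta>_closed m_closed)
    with 1 show ?thesis
      using \<gamma>_comm[of "(r, s)" "Zv u"] by (simp add: r_cancel)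
  qed
  have "\<gamma> w = \<gamma> w \<otimes> (z \<otimes> (z \<otimes> (z \<otimes> z)))"
    by (simp add: zzzz)
  also have "\<dots> = z \<otimes> (z \<otimes> (z \<otimes> (z \<otimes> \<gamma> (Zv (Zv (Zv (Zv w)))))))"
    by (simp only: \<gamma>_z' \<gamma>_z z_closed m_closed)
  also have "\<dots> = (z \<otimes> (z \<otimes> (z \<otimes> z))) \<otimes> \<gamma> (Zv (Zv (Zv (Zv w))))"
    by (simp add: m_assoc)
  also have "\<dots> = \<gamma> (Zv (Zv w))"
    by (simp add: zzzz cube)
  finally show ?thesis by simp
qed

lemma \<gamma>_inv_z: "\<gamma> w \<otimes> inv z = inv z \<otimes> \<gamma> (Zv w)"
proof -
  have "\<gamma> (Zv w) \<otimes> z = z \<otimes> \<gamma> w"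
    using \<gamma>_z[of "Zv w"] by (simp only: \<gamma>_Z_Z)
  then have "\<gamma> (Zv w) = z \<otimes> \<gamma> w \<otimes> inv z"
    by (simp add: inv_solve_right)
  then show ?thesis
    by (simp add: inv_solve_left m_assoc)
qed

lemma \<gamma>_inv_z': "g \<in> carrier G \<Longrightarrow> \<gamma> w \<otimes> (inv z \<otimes> g) = inv z \<otimes> (\<gamma> (Zv w) \<otimes> g)"
  using \<gamma>_inv_z[of w] by (simp add: m_assoc[symmetric])

lemma z_inv_z [simp]: "g \<in> carrier G \<Longrightarrow> z \<otimes> (inv z \<otimes> g) = g"
  "g \<in> carrier G \<Longrightarrow> inv z \<otimes> (z \<otimes> g) = g"
  by (simp_all add: m_assoc[symmetric])

abbreviation v :: "int \<times> int" where "v \<equiv> (r, s)"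

lemma inv_z_t: "inv z \<otimes> t = t \<otimes> (z \<otimes> \<gamma> (Zv v))"
proof -
  have "inv z \<otimes> t \<otimes> z = t \<otimes> (z \<otimes> (z \<otimes> \<gamma> v))"
    by (simp add: m_assoc t_z)
  then have "inv z \<otimes> t = t \<otimes> (z \<otimes> (z \<otimes> \<gamma> v)) \<otimes> inv z"
    by (simp add: inv_solve_right)
  also have "\<dots> = t \<otimes> (z \<otimes> (z \<otimes> (\<gamma> v \<otimes> inv z)))"
    by (simp add: m_assoc)
  also have "\<dots> = t \<otimes> (z \<otimes> \<gamma> (Zv v))"
    unfolding \<gamma>_inv_z by simp
  finally show ?thesis .
qed

text \<open>
  The relation \<open>t ^ z = t z\<^sup>2 v\<close>, solved for \<open>z ^ t\<close>: it shows that \<open>t\<close> normalizes the subgroup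
  generated by \<open>B\<close> and \<open>z\<close>, on which it inverts \<open>z\<close> up to an element of \<open>B\<close>.
\<close>
lemma z_t: "z \<otimes> t = t \<otimes> (inv z \<otimes> \<gamma> (- v))"
proof -
  have "t \<otimes> inv z = z \<otimes> (inv z \<otimes> t) \<otimes> inv z"
    by simp
  also have "\<dots> = z \<otimes> (t \<otimes> (z \<otimes> (\<gamma> (Zv v) \<otimes> inv z)))"
    unfolding inv_z_t by (simp add: m_assoc)
  also have "\<dots> = z \<otimes> (t \<otimes> \<gamma> v)"
    unfolding \<gamma>_inv_z \<gamma>_Z_Z by simp
  finally have "t \<otimes> inv z \<otimes> \<gamma> (- v) = z \<otimes> (t \<otimes> (\<gamma> v \<otimes> \<gamma> (- v)))"
    by (simp add: m_assoc)
  also have "\<dots> = z \<otimes> t"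
    by (simp add: \<beta>_mult)
  finally show ?thesis by (simp add: m_assoc)
qed

lemma z_t': "g \<in> carrier G \<Longrightarrow> z \<otimes> (t \<otimes> g) = t \<otimes> (inv z \<otimes> (\<gamma> (- v) \<otimes> g))"
  using z_t by (simp add: m_assoc[symmetric])

text \<open>
  Conjugating \<open>z\<close> by \<open>t\<close> twice multiplies it by \<open>Z v - J v\<close>, but \<open>t\<^sup>2 = 1\<close>.
\<close>
lemma \<gamma>_Z_v: "\<gamma> (Zv v) = \<gamma> (prod.swap v)"
proof -
  have "z = z \<otimes> t \<otimes> t"
    by (simp add: m_assoc t_t)
  also have "\<dots> = t \<otimes> (inv z \<otimes> (\<gamma> (- v) \<otimes> t))"
    unfolding z_t by (simp add: m_assoc)
  also have "\<dots> = t \<otimes> (inv z \<otimes> t) \<otimes> \<gamma> (prod.swap (- v))"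
    unfolding \<gamma>_t by (simp add: m_assoc)
  also have "\<dots> = z \<otimes> (\<gamma> (Zv v) \<otimes> \<gamma> (prod.swap (- v)))"
    unfolding inv_z_t by (simp add: m_assoc)
  finally have "\<gamma> (Zv v) \<otimes> \<gamma> (prod.swap (- v)) = \<one>"
    using l_cancel_one'[of z "\<gamma> (Zv v) \<otimes> \<gamma> (prod.swap (- v))"] by simp
  then have "\<gamma> (Zv v) = inv (\<gamma> (prod.swap (- v)))"
    by (simp add: inv_equality)
  then show ?thesis by (simp add: \<beta>_inv)
qed

text \<open>
  Moving \<open>t\<close> to the left through \<open>z ^ 4\<close> turns it into \<open>(z ^ {-1} (-v)) ^ 4\<close>, which is \<open>z ^ {-4}\<close> times
  \<open>- 2 (v + Z v)\<close>; both fourth powers are trivial.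
\<close>
lemma \<gamma>_2_v_Z_v: "\<gamma> (2 * (r + fst (Zv v)), 2 * (s + snd (Zv v))) = \<one>"
proof -
  let ?u = "\<gamma> (Zv (- v)) \<otimes> \<gamma> (- v)"
  have zz: "z \<otimes> (z \<otimes> t) = t \<otimes> (inv z \<otimes> (inv z \<otimes> ?u))"
    by (simp only: z_t z_t' \<gamma>_inv_z' z_closed closed \<beta>_closed m_closed inv_closed)
  have u: "?u = \<gamma> (Zv (- v) + (- v))"
    by (simp add: \<beta>_mult)
  have "t = (z \<otimes> (z \<otimes> (z \<otimes> z))) \<otimes> t"
    by (simp add: zzzz)
  also have "\<dots> = z \<otimes> (z \<otimes> (z \<otimes> (z \<otimes> t)))"
    by (simp add: m_assoc)
  also have "\<dots> = z \<otimes> (z \<otimes> (t \<otimes> (inv z \<otimes> (inv z \<otimes> ?u))))"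
    by (simp only: zz)
  also have "\<dots> = (z \<otimes> (z \<otimes> t)) \<otimes> (inv z \<otimes> (inv z \<otimes> ?u))"
    by (simp add: m_assoc)
  also have "\<dots> = t \<otimes> (inv z \<otimes> (inv z \<otimes> (?u \<otimes> (inv z \<otimes> (inv z \<otimes> ?u)))))"
    by (simp only: zz) (simp add: m_assoc)
  also have "\<dots> = t \<otimes> ((inv z \<otimes> (inv z \<otimes> (inv z \<otimes> inv z))) \<otimes> (?u \<otimes> ?u))"
    unfolding u by (simp add: \<gamma>_inv_z' \<gamma>_Z_Z m_assoc del: fst_add snd_add)
  also have "inv z \<otimes> (inv z \<otimes> (inv z \<otimes> inv z)) = inv (z \<otimes> (z \<otimes> (z \<otimes> z)))"
    by (simp add: inv_mult_group m_assoc)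
  finally have "?u \<otimes> ?u = \<one>"
    using l_cancel_one'[of t "?u \<otimes> ?u"] by (simp add: zzzz)
  then have "inv (?u \<otimes> ?u) = \<one>" by simp
  then show ?thesis
    by (simp add: \<beta>_mult \<beta>_inv circulant_def algebra_simps)
qed

lemma conditions_if_faithful:
  assumes faithful: "\<And>x y. \<beta> x y = \<one> \<Longrightarrow> N dvd x \<and> N dvd y"
  shows "[P * P + q * q = 1] (mod N)" "[2 * P * q = 0] (mod N)"
    and "[P * r + q * s = s] (mod N)" "[q * r + P * s = r] (mod N)"
    and "[2 * (r + (P * r + q * s)) = 0] (mod N)" "[2 * (s + (q * r + P * s)) = 0] (mod N)"
proof -
  have cong: "[x = x'] (mod N)" "[y = y'] (mod N)" if "\<beta> x y = \<beta> x' y'" for x y x' y'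
  proof -
    have "\<beta> (x - x') (y - y') = \<beta> x y \<otimes> inv (\<beta> x' y')"
      by (simp add: \<beta>_inv \<beta>_mult)
    with that have "\<beta> (x - x') (y - y') = \<one>" by simp
    from faithful[OF this] show "[x = x'] (mod N)" "[y = y'] (mod N)"
      by (simp_all add: cong_iff_dvd_diff)
  qed
  show "[P * P + q * q = 1] (mod N)" "[2 * P * q = 0] (mod N)"
    using cong[OF \<gamma>_Z_Z[of "(1, 0)"]] by (simp_all add: circulant_def algebra_simps)
  show "[P * r + q * s = s] (mod N)" "[q * r + P * s = r] (mod N)"
    using cong[OF \<gamma>_Z_v] by (simp_all add: circulant_def)
  show "[2 * (r + (P * r + q * s)) = 0] (mod N)" "[2 * (s + (q * r + P * s)) = 0] (mod N)"
    using cong[OF \<gamma>_2_v_Z_v[folded \<beta>_0]] by (simp_all add: circulant_def)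
qed

text \<open>
  The proof shows that the elements \<open>x\<close> for which both \<open>x\<close> and its inverse conjugate \<open>B\<close> into itself
  form a subgroup containing the generators.  Asking for both at once makes closure under inverses
  immediate.
\<close>
lemma base_normal:
  assumes gen: "carrier G = generate G {a, b, t, z}"
  shows "base \<lhd> G"
proof -
  let ?S = "{x \<in> carrier G. \<forall>g\<in>base. x \<otimes> g \<otimes> inv x \<in> base \<and> inv x \<otimes> g \<otimes> x \<in> base}"
  have base_closed: "g \<in> carrier G" if "g \<in> base" for g
    using that subgroup.subset[OF subgroup_base] by blast
  have "subgroup ?S G"
  proof (rule subgroupI)
    fix x y assume x: "x \<in> ?S" and y: "y \<in> ?S"
    have "x \<otimes> y \<otimes> g \<otimes> inv (x \<otimes> y) \<in> base \<and> inv (x \<otimes> y) \<otimes> g \<otimes> (x \<otimes> y) \<in> base"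
      if g: "g \<in> base" for g
    proof -
      have "x \<otimes> y \<otimes> g \<otimes> inv (x \<otimes> y) = x \<otimes> (y \<otimes> g \<otimes> inv y) \<otimes> inv x"
        and "inv (x \<otimes> y) \<otimes> g \<otimes> (x \<otimes> y) = inv y \<otimes> (inv x \<otimes> g \<otimes> x) \<otimes> y"
        using x y base_closed[OF g] by (simp_all add: m_assoc inv_mult_group)
      then show ?thesis
        using x y g by simp
    qed
    then show "x \<otimes> y \<in> ?S"
      using x y by simp
  qed (auto intro: exI[of _ \<one>] simp: base_closed)
  moreover have "{a, b, t, z} \<subseteq> ?S"
  proof -
    have "\<beta> x y \<in> ?S" for x y
      by (auto simp: \<beta>_inv \<beta>_mult elim!: baseE)
    from this[of 1 0] this[of 0 1] have "a \<in> ?S" "b \<in> ?S"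
      by (simp_all only: \<beta>_10 \<beta>_01)
    moreover have "t \<in> ?S"
      by (auto simp: m_assoc \<beta>_t elim!: baseE)
    moreover have "z \<in> ?S"
    proof -
      have "z \<otimes> \<gamma> w \<otimes> inv z = \<gamma> (Zv w)" "inv z \<otimes> \<gamma> w \<otimes> z = \<gamma> (Zv w)" for w
        by (simp_all add: m_assoc \<gamma>_z \<gamma>_inv_z)
      from this[of "(x, y)" for x y] show ?thesis
        by (auto elim!: baseE)
    qed
    ultimately show ?thesis by blast
  qed
  ultimately have "generate G {a, b, t, z} \<subseteq> ?S"
    by (rule generate_subgroup_incl[rotated])
  then show ?thesis
    unfolding normal_inv_iff gen[symmetric] using subgroup_base by blast
qed

abbreviation "H \<equiv> generate G {a, b, t}"
abbreviation "K \<equiv> generate G {z}"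

lemma subgroup_H: "subgroup H G" and subgroup_K: "subgroup K G"
  by (rule generate_is_subgroup, blast)+

text \<open>
  Since \<open>B\<close> is normal, \<open>L = B K\<close> is a subgroup, and \<open>t\<close> normalizes it by \<open>z_t\<close>.  Hence \<open>H K = H L\<close> is
  closed under right multiplication by every generator: \<open>h l t = (h t) (t l t)\<close>.
\<close>
lemma carrier_eq_H_K:
  assumes gen: "carrier G = generate G {a, b, t, z}"
  shows "carrier G = H <#> K"
proof -
  note H_closed = subgroup.mem_carrier[OF subgroup_H]
  note K_closed = subgroup.mem_carrier[OF subgroup_K]
  have base_H: "base \<subseteq> H" by (simp add: generate_abt)
  have t_H: "t \<in> H" by (auto intro: generate.incl)
  let ?L = "base <#> K"
  have L: "subgroup ?L G"
    by (rule mult_norm_subgroup[OF base_normal[OF gen] subgroup_K])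
  have base_L: "base \<subseteq> ?L"
    using subgroup.subset[OF subgroup_base] generate.one[of G "{z}"] by (force simp: set_mult_def)
  have K_L: "K \<subseteq> ?L"
  proof
    fix k assume "k \<in> K"
    then show "k \<in> ?L"
      using K_closed[of k] one_in_base l_one[of k] unfolding set_mult_def by blast
  qed
  have H_L: "h \<otimes> l \<in> H <#> K" if h: "h \<in> H" and "l \<in> ?L" for h l
  proof -
    obtain g k where l: "l = g \<otimes> k" "g \<in> base" "k \<in> K"
      using \<open>l \<in> ?L\<close> by (auto simp: set_mult_def)
    have "h \<otimes> l = (h \<otimes> g) \<otimes> k"
      using h l base_H H_closed K_closed by (simp add: l(1) m_assoc subsetD)
    moreover have "h \<otimes> g \<in> H"
      using h l(2) base_H subgroup.m_closed[OF subgroup_H] by blast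
    ultimately show ?thesis using l(3) by (auto simp: set_mult_def)
  qed
  have z_L: "z \<in> ?L" using K_L by (auto intro: generate.incl)
  have t_conj: "t \<otimes> l \<otimes> t \<in> ?L" if "l \<in> ?L" for l
  proof -
    obtain g k where l: "l = g \<otimes> k" "g \<in> base" "k \<in> K"
      using \<open>l \<in> ?L\<close> by (auto simp: set_mult_def)
    obtain j :: int where k: "k = z [^] j"
      using l(3) by (auto simp: generate_pow)
    have g: "t \<otimes> g \<otimes> t \<in> ?L" "g \<in> carrier G"
      using l(2) base_L by (auto simp: m_assoc \<beta>_t elim!: baseE)
    have y: "inv z \<otimes> \<gamma> (- v) \<in> ?L"
      using base_L by (auto intro!: subgroup.m_closed[OF L] subgroup.m_inv_closed[OF L] z_L)
    have "k \<otimes> t = t \<otimes> (inv z \<otimes> \<gamma> (- v)) [^] j"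
      unfolding k by (rule int_pow_intertwine) (simp_all add: z_t)
    then have "t \<otimes> l \<otimes> t = (t \<otimes> g \<otimes> t) \<otimes> (inv z \<otimes> \<gamma> (- v)) [^] j"
      using g(2) l K_closed by (simp add: m_assoc)
    then show ?thesis
      using subgroup.m_closed[OF L g(1) subgroup_int_pow_closed[OF L y]] by simp
  qed
  have L_closed: "l \<in> carrier G" if "l \<in> ?L" for l
    using that subgroup.subset[OF L] by blast
  let ?S = "{x \<in> carrier G. \<forall>h\<in>H. \<forall>l\<in>?L. h \<otimes> l \<otimes> x \<in> H <#> K}"
  have L_S: "l \<in> ?S" if l: "l \<in> ?L" for l
  proof -
    have "h \<otimes> m \<otimes> l \<in> H <#> K" if hm: "h \<in> H" "m \<in> ?L" for h m
      using H_L[OF hm(1) subgroup.m_closed[OF L hm(2) l]] H_closed[OF hm(1)] L_closed[OF hm(2)]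
        L_closed[OF l] by (simp only: m_assoc)
    with L_closed[OF l] show ?thesis by simp
  qed
  have S_mult: "x \<otimes> y \<in> ?S" if x: "x \<in> ?S" and y: "y \<in> ?S" for x y
  proof -
    have "h \<otimes> l \<otimes> (x \<otimes> y) \<in> H <#> K" if hl: "h \<in> H" "l \<in> ?L" for h l
    proof -
      have "h \<otimes> l \<otimes> x \<in> H <#> K" using x hl by blast
      then obtain h' k where h': "h' \<in> H" and k: "k \<in> K" and eq: "h \<otimes> l \<otimes> x = h' \<otimes> k"
        by (auto simp: set_mult_def)
      have "h \<otimes> l \<otimes> (x \<otimes> y) = h' \<otimes> k \<otimes> y"
        unfolding eq[symmetric] using x y H_closed[OF hl(1)] L_closed[OF hl(2)] by (simp add: m_assoc)
      moreover have "h' \<otimes> k \<otimes> y \<in> H <#> K"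
        using y h' subsetD[OF K_L k] by blast
      ultimately show ?thesis by (simp only:)
    qed
    with x y show ?thesis by simp
  qed
  have t_S: "t \<in> ?S"
  proof -
    have "h \<otimes> l \<otimes> t \<in> H <#> K" if hl: "h \<in> H" "l \<in> ?L" for h l
    proof -
      have "h \<otimes> l \<otimes> t = (h \<otimes> t) \<otimes> (t \<otimes> l \<otimes> t)"
        using hl H_closed L_closed by (simp add: m_assoc)
      then show ?thesis
        using H_L[OF _ t_conj[OF hl(2)]] hl(1) t_H subgroup.m_closed[OF subgroup_H] by simp
    qed
    then show ?thesis by simp
  qed
  have gens: "x \<in> ?S \<and> inv x \<in> ?S" if "x \<in> {a, b, t, z}" for x
  proof (cases "x = t")
    case True
    then show ?thesis using t_S by simp
  next
    case False
    have "a \<in> base" "b \<in> base"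
      using \<beta>_in_base[of 1 0] \<beta>_in_base[of 0 1] by (simp_all add: \<beta>_10 \<beta>_01)
    then have "x \<in> ?L" using False that base_L z_L by blast
    then show ?thesis using L_S subgroup.m_inv_closed[OF L] by blast
  qed
  have gen_S: "x \<in> ?S" if "x \<in> generate G {a, b, t, z}" for x
    using that
  proof (induction rule: generate.induct)
    case one
    show ?case by (rule L_S[OF subgroup.one_closed[OF L]])
  next
    case (incl x)
    then show ?case using gens by (simp only:)
  next
    case (inv x)
    then show ?case using gens by (simp only:)
  next
    case (eng x y)
    show ?case by (rule S_mult[OF eng.IH])
  qed
  have "x \<in> H <#> K" if "x \<in> carrier G" for x
  proof -
    have "x \<in> ?S" using that gen_S unfolding gen by (simp only:)
    then have "\<one> \<otimes> \<one> \<otimes> x \<in> H <#> K"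
      using subgroup.one_closed[OF subgroup_H] subgroup.one_closed[OF L] by blast
    then show ?thesis using that by simp
  qed
  moreover have "H <#> K \<subseteq> carrier G"
    using H_closed K_closed by (auto simp: set_mult_def)
  ultimately show ?thesis by (auto simp only: subset_eq set_eq_iff)
qed

text \<open>
  If \<open>H\<close> were normal, it would contain \<open>t ^ z = t z\<^sup>2 v\<close> and therefore \<open>z\<^sup>2\<close>, although 4 does not
  divide 2.
\<close>
lemma nonsplit_if_z_free:
  assumes gen: "carrier G = generate G {a, b, t, z}"
    and free: "\<And>k :: int. z [^] k \<in> H \<Longrightarrow> 4 dvd k"
  shows "nonsplit_exact_product G H K"
proof -
  have z_pow: "z [^] k = \<one>" if "4 dvd k" for k :: int
    using int_pow_cong[OF z_closed z_4, of k 0] that by (simp add: cong_0_iff)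
  have "H \<inter> K = {\<one>}"
    using free z_pow subgroup.one_closed[OF subgroup_H] subgroup.one_closed[OF subgroup_K]
    by (auto simp: generate_pow)
  then have exact: "exact_product G H K"
    unfolding exact_product_def
    using carrier_eq_H_K[OF gen] subgroup_H subgroup_K is_group by blast
  have "\<not> H \<lhd> G"
  proof
    assume "H \<lhd> G"
    have H: "\<beta> x y \<in> H" "t \<in> H" for x y
      by (simp add: generate_abt) (simp add: generate.incl)
    have "inv z \<otimes> t \<otimes> z \<in> H"
      using normal.inv_op_closed1[OF \<open>H \<lhd> G\<close> z_closed H(2)] .
    also have "inv z \<otimes> t \<otimes> z = t \<otimes> z [^] (2 :: int) \<otimes> \<gamma> v"
      using int_pow_int[of G z 2] by (simp add: m_assoc t_z numeral_2_eq_2)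
    finally have "t \<otimes> (t \<otimes> z [^] (2 :: int) \<otimes> \<gamma> v) \<otimes> inv \<gamma> v \<in> H"
      using H by (simp add: subgroup.m_closed[OF subgroup_H] subgroup.m_inv_closed[OF subgroup_H])
    then have "z [^] (2 :: int) \<in> H" by (simp add: m_assoc)
    from free[OF this] show False by simp
  qed
  with exact show ?thesis
    by (simp add: nonsplit_exact_product_def split_exact_product_def)
qed

lemma K_cyclic_if_z_free:
  assumes free: "\<And>k :: int. z [^] k \<in> H \<Longrightarrow> 4 dvd k"
  shows "G\<lparr>carrier := K\<rparr> \<cong> integer_mod_group 4"
proof -
  have cong: "z [^] j = z [^] (k :: int) \<longleftrightarrow> [j = k] (mod 4)" for j k
  proof
    assume "z [^] j = z [^] k"
    then have "z [^] (j - k) = \<one>" by (simp add: int_pow_diff)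
    then have "4 dvd j - k" by (intro free) (simp add: generate.one)
    then show "[j = k] (mod 4)" by (simp add: cong_iff_dvd_diff)
  qed (rule int_pow_cong[OF z_closed z_4])
  have "(\<lambda>k. z [^] k) \<in> iso (integer_mod_group 4) (G\<lparr>carrier := K\<rparr>)"
  proof (rule isoI)
    show "(\<lambda>k. z [^] k) \<in> hom (integer_mod_group 4) (G\<lparr>carrier := K\<rparr>)"
      by (rule homI) (auto simp: generate_pow int_pow_mult[symmetric] cong cong_def)
    have "z [^] k \<in> (\<lambda>k. z [^] k) ` {0..<4::int}" for k :: int
      by (rule image_eqI[of _ _ "k mod 4"]) (simp_all add: cong)
    then show "bij_betw (\<lambda>k. z [^] k) (carrier (integer_mod_group 4)) (carrier (G\<lparr>carrier := K\<rparr>))"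
      by (auto simp: bij_betw_def inj_on_def carrier_integer_mod_group cong cong_def generate_pow)
  qed
  then show ?thesis
    using group.iso_sym[OF group_integer_mod_group is_isoI] by blast
qed

end

section \<open>A faithful action\<close>

text \<open>
  An action of words on a type, considered up to an equivalence \<open>E\<close>; a word acts by its letters from
  left to right.  Working up to \<open>E\<close> allows residue classes to be handled through integers.
\<close>
lemma word_eq_action:
  assumes "word_eq R u v" and E: "equivp E"
    and resp: "\<And>l \<xi> \<eta>. E \<xi> \<eta> \<Longrightarrow> E (act l \<xi>) (act l \<eta>)"
    and cancel: "\<And>x e \<xi>. E (act (x, \<not> e) (act (x, e) \<xi>)) \<xi>"
    and rel: "\<And>l r \<xi>. (l, r) \<in> R \<Longrightarrow> E (fold act l \<xi>) (fold act r \<xi>)"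
  shows "E (fold act u \<xi>) (fold act v \<xi>)"
proof -
  have fold_resp: "E (fold act w \<xi>) (fold act w \<eta>)" if "E \<xi> \<eta>" for w \<xi> \<eta>
    using that by (induction w arbitrary: \<xi> \<eta>) (auto intro: resp)
  show ?thesis
    using assms(1)
  proof (induction arbitrary: \<xi> rule: word_eq.induct)
    case (refl u)
    show ?case by (rule equivp_reflp[OF E])
  next
    case (sym u v)
    then show ?case by (blast intro: equivp_symp[OF E])
  next
    case (trans u v w)
    then show ?case by (blast intro: equivp_transp[OF E])
  next
    case (cancel u x e v)
    show ?case by (simp add: fold_resp assms(4))
  next
    case (rel l r u v)
    then show ?case by (simp add: fold_resp assms(5))
  qed
qed

type_synonym state = "int \<times> int \<times> int"

text \<open>
  The three conditions in coordinates, with \<open>P = 1 + p\<close>: \<open>Z\<^sup>2 = I\<close>, \<open>Z v = J v\<close> and \<open>2 (I + Z) v = 0\<close>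
  modulo \<open>N\<close>.  In the presence of \<open>Z v = J v\<close> the last one is \<open>2 (I + J) v = 0\<close>, which is the single
  congruence \<open>two_v\<close>, since \<open>(I + J) v = (r + s, r + s)\<close>.
\<close>
locale extension_data =
  fixes N P q r s :: int
  assumes Z_Z: "[P * P + q * q = 1] (mod N)" "[2 * P * q = 0] (mod N)"
    and Z_v: "[P * r + q * s = s] (mod N)" "[q * r + P * s = r] (mod N)"
    and two_v: "[2 * (r + s) = 0] (mod N)"
begin

text \<open>
  The state \<open>(k, x, y)\<close> represents the element \<open>z ^ k a ^ x b ^ y\<close> of \<open>L = (\<int> / N)\<^sup>2 \<rtimes> C\<^sub>4\<close>.
\<close>
fun eqv :: "state \<Rightarrow> state \<Rightarrow> bool" where
  "eqv (k, x, y) (k', x', y') \<longleftrightarrow> [k = k'] (mod 4) \<and> [x = x'] (mod N) \<and> [y = y'] (mod N)"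

lemma equivp_eqv: "equivp eqv"
  by (rule equivpI) (auto intro!: reflpI sympI transpI intro: cong_sym cong_trans)

lemma eqv_refl [simp]: "eqv \<xi> \<xi>"
  by (rule equivp_reflp[OF equivp_eqv])

lemma eqv_trans: "eqv \<xi> \<eta> \<Longrightarrow> eqv \<eta> \<theta> \<Longrightarrow> eqv \<xi> \<theta>"
  by (rule equivp_transp[OF equivp_eqv])

text \<open>
  The coordinates of \<open>v + Z v + \<dots> + Z ^ (k - 1) v\<close>, where \<open>v + Z v\<close> has been replaced by
  \<open>v + J v = (r + s, r + s)\<close>, which \<open>Z\<close> fixes; \<open>w\<close> is the coordinate of \<open>v\<close>.  Division rounds down,
  which gives the right value for negative \<open>k\<close> as well.  This vector is what the
  automorphism \<open>t\<close> subtracts: the image of \<open>z ^ k\<close> is \<open>(z ^ {-1} (-v)) ^ k\<close>.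
\<close>
definition shift :: "int \<Rightarrow> int \<Rightarrow> int" where
  "shift k w = (k div 2) * (r + s) + (k mod 2) * w"

lemma shift_even: "shift (2 * h) w = h * (r + s)"
  and shift_odd: "shift (2 * h + 1) w = h * (r + s) + w"
  by (simp_all add: shift_def)

text \<open>
  Right translation by \<open>a\<close>, \<open>b\<close> and \<open>z\<close>; the latter applies \<open>Z\<close> because \<open>w z = z (Z w)\<close> for \<open>w \<in> B\<close>.
  The letter \<open>t\<close> acts as the automorphism of \<open>L\<close>.  An inverse letter \<open>z ^ {-1}\<close> applies \<open>Z\<close> again, as
  \<open>Z\<close> is its own inverse modulo \<open>N\<close>, and \<open>t ^ {-1}\<close> acts like \<open>t\<close>.
\<close>
fun act :: "gen \<times> bool \<Rightarrow> state \<Rightarrow> state" where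
  "act (Ga, e) (k, x, y) = (k, (if e then x + 1 else x - 1), y)"
| "act (Gb, e) (k, x, y) = (k, x, (if e then y + 1 else y - 1))"
| "act (Gt, e) (k, x, y) = (- k, y - shift k r, x - shift k s)"
| "act (Gz, e) (k, x, y) = ((if e then k + 1 else k - 1), P * x + q * y, q * x + P * y)"

lemma act_t_t: "act (Gt, e') (act (Gt, e) \<xi>) = \<xi>"
proof -
  obtain k x y where \<xi>: "\<xi> = (k, x, y)" by (cases \<xi>)
  show ?thesis
  proof (cases "even k")
    case True
    then obtain h where k: "k = 2 * h" by blast
    have "- k = 2 * (- h)" by (simp add: k)
    then show ?thesis
      by (simp only: \<xi> act.simps shift_even k) simp
  next
    case False
    then obtain h where k: "k = 2 * h + 1" using oddE by blast
    have mk: "- (2 * h + 1) = 2 * (- h - 1) + 1" by simp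
    show ?thesis
      by (simp only: \<xi> act.simps k mk shift_odd) (simp add: algebra_simps)
  qed
qed

lemma Z_Z_cong: "[P * (P * x + q * y) + q * (q * x + P * y) = x] (mod N)"
  "[q * (P * x + q * y) + P * (q * x + P * y) = y] (mod N)"
proof -
  have "[x * (P * P + q * q) + y * (2 * P * q) = x * 1 + y * 0] (mod N)"
    "[y * (P * P + q * q) + x * (2 * P * q) = y * 1 + x * 0] (mod N)"
    by (intro cong_add cong_scalar_left Z_Z)+
  then show "[P * (P * x + q * y) + q * (q * x + P * y) = x] (mod N)"
    "[q * (P * x + q * y) + P * (q * x + P * y) = y] (mod N)"
    by (simp_all add: algebra_simps)
qed

lemma act_resp:
  assumes "eqv \<xi> \<eta>"
  shows "eqv (act l \<xi>) (act l \<eta>)"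
proof -
  obtain k x y k' x' y' where \<xi>: "\<xi> = (k, x, y)" and \<eta>: "\<eta> = (k', x', y')"
    by (cases \<xi>, cases \<eta>)
  have k: "[k = k'] (mod 4)" and x: "[x = x'] (mod N)" and y: "[y = y'] (mod N)"
    using assms by (simp_all add: \<xi> \<eta>)
  obtain g e where l: "l = (g, e)" by fastforce
  show ?thesis
  proof (cases g)
    case Gt
    obtain j where j: "k' = k + 4 * j" using k by (metis cong_iff_lin)
    have sh: "[shift k w = shift k' w] (mod N)" for w
    proof -
      have "shift k' w = shift k w + j * (2 * (r + s))"
      proof -
        have "k' = k + 2 * (2 * j)" by (simp add: j)
        then have "k' div 2 = k div 2 + 2 * j" "k' mod 2 = k mod 2" by presburger+
        then show ?thesis by (simp add: shift_def algebra_simps)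
      qed
      moreover have "[shift k w + j * 0 = shift k w + j * (2 * (r + s))] (mod N)"
        by (intro cong_add cong_scalar_left cong_refl cong_sym[OF two_v])
      ultimately show ?thesis by simp
    qed
    show ?thesis
      unfolding \<xi> \<eta> l Gt by (simp add: k x y sh cong_diff cong_minus_minus_iff)
  qed (auto simp: \<xi> \<eta> l k x y intro!: cong_add cong_diff cong_scalar_left)
qed

lemma act_cancel: "eqv (act (g, \<not> e) (act (g, e) \<xi>)) \<xi>"
  using Z_Z_cong by (cases \<xi>; cases g) (auto simp: act_t_t simp del: act.simps(3))

lemma fold_act_resp: "eqv \<xi> \<eta> \<Longrightarrow> eqv (fold act u \<xi>) (fold act u \<eta>)"
  by (induction u arbitrary: \<xi> \<eta>) (simp_all add: act_resp del: act.simps eqv.simps)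

lemma fold_act_a: "fold act (wpow (wgen Ga) j) (k, x, y) = (k, x + j, y)"
proof -
  have "fold act (concat (replicate i [(Ga, True)])) (k, x, y) = (k, x + int i, y)" for i x
    by (induction i arbitrary: x) simp_all
  moreover have "fold act (concat (replicate i [(Ga, False)])) (k, x, y) = (k, x - int i, y)" for i x
    by (induction i arbitrary: x) simp_all
  ultimately show ?thesis by (simp add: wpow_def winv_def wgen_def)
qed

lemma fold_act_b: "fold act (wpow (wgen Gb) j) (k, x, y) = (k, x, y + j)"
proof -
  have "fold act (concat (replicate i [(Gb, True)])) (k, x, y) = (k, x, y + int i)" for i y
    by (induction i arbitrary: y) simp_all
  moreover have "fold act (concat (replicate i [(Gb, False)])) (k, x, y) = (k, x, y - int i)" for i y
    by (induction i arbitrary: y) simp_all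
  ultimately show ?thesis by (simp add: wpow_def winv_def wgen_def)
qed

lemma fst_fold_act_z: "fst (fold act (wpow (wgen Gz) j) \<xi>) = fst \<xi> + j"
proof -
  have "fst (fold act (concat (replicate i [(Gz, True)])) \<xi>) = fst \<xi> + int i" for i \<xi>
    by (induction i arbitrary: \<xi>) auto
  moreover have "fst (fold act (concat (replicate i [(Gz, False)])) \<xi>) = fst \<xi> - int i" for i \<xi>
    by (induction i arbitrary: \<xi>) auto
  ultimately show ?thesis by (simp add: wpow_def winv_def wgen_def)
qed

text \<open>
  Even powers of \<open>z\<close> leave the base coordinates alone, so they need not be tracked through \<open>z ^ (2 c)\<close>.
\<close>
lemma fold_act_z_even: "eqv (fold act (wpow (wgen Gz) (2 * j)) (k, x, y)) (k + 2 * j, x, y)"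
proof -
  let ?d = "\<lambda>e. if e then 1 else - 1 :: int"
  have two: "eqv (act (Gz, e) (act (Gz, e) (k, x, y))) (k + 2 * ?d e, x, y)" for e k
    using Z_Z_cong by (auto simp: add.commute[of 2])
  have nat: "eqv (fold act (concat (replicate (2 * i) [(Gz, e)])) (k, x, y)) (k + 2 * ?d e * int i, x, y)"
    for i e k
  proof (induction i arbitrary: k)
    case (Suc i)
    have "eqv (fold act (concat (replicate (2 * Suc i) [(Gz, e)])) (k, x, y))
        (fold act (concat (replicate (2 * i) [(Gz, e)])) (k + 2 * ?d e, x, y))"
      using fold_act_resp[OF two, of "concat (replicate (2 * i) [(Gz, e)])"] by (simp del: act.simps)
    with Suc.IH[of "k + 2 * ?d e"] show ?case
      by (auto intro: eqv_trans simp: algebra_simps)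
  qed simp
  show ?thesis
    using nat[of "nat j" True] nat[of "nat (- j)" False]
    by (auto simp: wpow_def winv_def wgen_def nat_mult_distrib
        simp flip: mult_minus_right)
qed

text \<open>
  The recursion \<open>Z S (k - 1) = S k - v\<close> for the partial sums \<open>S k = v + Z v + \<dots> + Z ^ (k - 1) v\<close>.
  It is exactly what the relation \<open>t ^ z = t z\<^sup>2 v\<close> demands of the action.
\<close>
lemma shift_Z:
  "[P * shift (k - 1) r + q * shift (k - 1) s = shift k r - r] (mod N)"
  "[q * shift (k - 1) r + P * shift (k - 1) s = shift k s - s] (mod N)"
proof -
  have sum: "[(P + q) * (r + s) = r + s] (mod N)"
    using cong_add[OF Z_v] by (simp add: algebra_simps)
  have "[P * shift (k - 1) r + q * shift (k - 1) s = shift k r - r] (mod N) \<and>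
    [q * shift (k - 1) r + P * shift (k - 1) s = shift k s - s] (mod N)"
  proof (cases "even k")
    case True
    then obtain h where k: "k = 2 * h" by blast
    have k1: "k - 1 = 2 * (h - 1) + 1" by (simp add: k)
    have "[(h - 1) * ((P + q) * (r + s)) + (P * r + q * s) = (h - 1) * (r + s) + s] (mod N)"
      "[(h - 1) * ((P + q) * (r + s)) + (q * r + P * s) = (h - 1) * (r + s) + r] (mod N)"
      by (intro cong_add cong_scalar_left sum Z_v)+
    then show ?thesis
      unfolding k1 shift_odd unfolding k shift_even by (simp add: algebra_simps)
  next
    case False
    then obtain h where k: "k = 2 * h + 1" using oddE by blast
    have k1: "k - 1 = 2 * h" by (simp add: k)
    have "[h * ((P + q) * (r + s)) = h * (r + s)] (mod N)"
      by (intro cong_scalar_left sum)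
    then show ?thesis
      unfolding k1 shift_even unfolding k shift_odd by (simp add: algebra_simps)
  qed
  then show "[P * shift (k - 1) r + q * shift (k - 1) s = shift k r - r] (mod N)"
    "[q * shift (k - 1) r + P * shift (k - 1) s = shift k s - s] (mod N)" by simp_all
qed

end

abbreviation wa :: "gen word" where "wa \<equiv> wgen Ga"
abbreviation wb :: "gen word" where "wb \<equiv> wgen Gb"
abbreviation wt :: "gen word" where "wt \<equiv> wgen Gt"
abbreviation wz :: "gen word" where "wz \<equiv> wgen Gz"

context extension_data
begin

text \<open>
  The action satisfies the defining relations of \<open>G\<close>.  All but the last one follow from \<open>Z\<^sup>2 = I\<close> and
  \<open>t\<^sup>2 = 1\<close>; the last one is \<open>shift_Z\<close>.
\<close>
lemma fold_act_relation:
  assumes "(l, r') \<in> G_relations n (P - 1) q r s c" and N: "N = 2 ^ n" and c: "odd c"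
  shows "eqv (fold act l \<xi>) (fold act r' \<xi>)"
proof -
  obtain k x y where \<xi>: "\<xi> = (k, x, y)" by (cases \<xi>)
  have N_cong: "[w + N = w] (mod N)" for w by (simp add: cong_def)
  have atrue: "fold act (wgen g) \<eta> = act (g, True) \<eta>" "fold act (winv (wgen g)) \<eta> = act (g, False) \<eta>" for g \<eta>
    by (simp_all add: wgen_def winv_def)
  note words = wconj_def wcomm_def atrue fold_append comp_apply
  have rels: "G_relations n (P - 1) q r s c =
    {(wpow wa N, []),
     (wpow wb N, []),
     (wpow wt 2, []),
     (wpow wz 4, []),
     (wcomm wa wb, []),
     (wconj wa wt, wb),
     (wconj wb wt, wa),
     (wconj wa wz, wpow wa P @ wpow wb q),
     (wconj wb wz, wpow wa q @ wpow wb P),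
     (wconj wt wz, wt @ wpow wz (2 * c) @ wpow wa r @ wpow wb s)}"
    by (simp add: G_relations_def Let_def N)
  have rel_a: "eqv (fold act (wpow wa N) \<xi>) (fold act [] \<xi>)"
    by (simp add: \<xi> fold_act_a N_cong)
  have rel_b: "eqv (fold act (wpow wb N) \<xi>) (fold act [] \<xi>)"
    by (simp add: \<xi> fold_act_b N_cong)
  have rel_t: "eqv (fold act (wpow wt 2) \<xi>) (fold act [] \<xi>)"
    by (simp add: wpow_def wgen_def numeral_2_eq_2 act_t_t del: act.simps)
  have rel_z: "eqv (fold act (wpow wz 4) \<xi>) (fold act [] \<xi>)"
  proof -
    have "eqv (k + 4, x, y) (k, x, y)" by (simp add: cong_def)
    with fold_act_z_even[of 2 k x y, simplified] show ?thesis
      unfolding \<xi> fold.simps id_apply by (rule eqv_trans)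
  qed
  have rel_ab: "eqv (fold act (wcomm wa wb) \<xi>) (fold act [] \<xi>)"
    by (simp add: \<xi> words)
  have rel_at: "eqv (fold act (wconj wa wt) \<xi>) (fold act wb \<xi>)"
  proof -
    have "act (Gt, True) (act (Ga, True) \<eta>) = act (Gb, True) (act (Gt, True) \<eta>)" for \<eta>
      by (cases \<eta>) simp
    then show ?thesis
      by (simp add: words act_t_t del: act.simps)
  qed
  have rel_bt: "eqv (fold act (wconj wb wt) \<xi>) (fold act wa \<xi>)"
  proof -
    have "act (Gt, True) (act (Gb, True) \<eta>) = act (Ga, True) (act (Gt, True) \<eta>)" for \<eta>
      by (cases \<eta>) simp
    then show ?thesis
      by (simp add: words act_t_t del: act.simps)
  qed
  have rel_az: "eqv (fold act (wconj wa wz) \<xi>) (fold act (wpow wa P @ wpow wb q) \<xi>)"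
    using cong_add[OF Z_Z_cong(1)[of x y] cong_refl[of P]]
      cong_add[OF Z_Z_cong(2)[of x y] cong_refl[of q]]
    by (simp add: \<xi> words fold_act_a fold_act_b algebra_simps)
  have rel_bz: "eqv (fold act (wconj wb wz) \<xi>) (fold act (wpow wa q @ wpow wb P) \<xi>)"
    using cong_add[OF Z_Z_cong(1)[of x y] cong_refl[of q]]
      cong_add[OF Z_Z_cong(2)[of x y] cong_refl[of P]]
    by (simp add: \<xi> words fold_act_a fold_act_b algebra_simps)
  have rel_tz: "eqv (fold act (wconj wt wz) \<xi>) (fold act (wt @ wpow wz (2 * c) @ wpow wa r @ wpow wb s) \<xi>)"
  proof -
    let ?x = "P * x + q * y" and ?y = "q * x + P * y" and ?S = "shift (k - 1)"
    have "eqv (fold act (wconj wt wz) \<xi>) (2 - k, y - shift k r + r, x - shift k s + s)"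
    proof -
      have "fold act (wconj wt wz) \<xi> = (2 - k, P * (?y - ?S r) + q * (?x - ?S s), q * (?y - ?S r) + P * (?x - ?S s))"
        by (simp add: \<xi> words)
      moreover have "[P * ?y + q * ?x - (P * ?S r + q * ?S s) = y - (shift k r - r)] (mod N)"
        "[q * ?y + P * ?x - (q * ?S r + P * ?S s) = x - (shift k s - s)] (mod N)"
        using Z_Z_cong[of y x] by (intro cong_diff shift_Z; simp add: algebra_simps)+
      ultimately show ?thesis by (simp add: algebra_simps)
    qed
    moreover have "eqv (fold act (wt @ wpow wz (2 * c) @ wpow wa r @ wpow wb s) \<xi>) (2 - k, y - shift k r + r, x - shift k s + s)"
    proof -
      have "eqv (fold act (wt @ wpow wz (2 * c) @ wpow wa r @ wpow wb s) \<xi>) (- k + 2 * c, y - shift k r + r, x - shift k s + s)"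
        using fold_act_resp[OF fold_act_z_even[of c "- k" "y - shift k r" "x - shift k s"],
            of "wpow wa r @ wpow wb s"]
        by (simp add: \<xi> words fold_act_a fold_act_b)
      moreover have "[- k + 2 * c = 2 - k] (mod 4)"
      proof -
        obtain d where "c = 2 * d + 1" using c oddE by blast
        then have "- k + 2 * c - (2 - k) = 4 * d" by simp
        then show ?thesis by (simp add: cong_iff_dvd_diff)
      qed
      ultimately show ?thesis by (auto intro: eqv_trans)
    qed
    ultimately show ?thesis
      using equivp_symp[OF equivp_eqv] eqv_trans by blast
  qed
  show ?thesis
    using assms(1) unfolding rels
    by (elim insertE emptyE Pair_inject)
       (simp_all only: rel_a rel_b rel_t rel_z rel_ab rel_at rel_bt rel_az rel_bz rel_tz)
qed

end

section \<open>Normal forms in the presented groups\<close>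

lemma (in group) commute_if_conj:
  assumes "g \<in> carrier G" "h \<in> carrier G" "k \<in> carrier G" "inv h \<otimes> (g \<otimes> h) = k"
  shows "g \<otimes> h = h \<otimes> k"
  using assms by (auto simp: m_assoc[symmetric])

lemma (in group) int_pow_2: "x \<in> carrier G \<Longrightarrow> x [^] (2 :: int) = x \<otimes> x"
  using int_pow_int[of G x 2] by (simp add: numeral_2_eq_2)

lemma (in group) wreathed_tripleI:
  assumes "a \<in> carrier G" "b \<in> carrier G" "t \<in> carrier G"
    and "a [^] N = \<one>" "b [^] N = \<one>" "t [^] (2 :: int) = \<one>"
    and comm: "inv a \<otimes> (inv b \<otimes> (a \<otimes> b)) = \<one>"
    and "inv t \<otimes> (a \<otimes> t) = b" "inv t \<otimes> (b \<otimes> t) = a"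
  shows "wreathed_triple G a b t N"
proof unfold_locales
  have "inv b \<otimes> (a \<otimes> b) = a"
    using comm assms(1,2) by (simp add: inv_solve_left')
  then show "a \<otimes> b = b \<otimes> a"
    using assms(1,2) by (intro commute_if_conj)
  show "t \<otimes> t = \<one>"
    using assms(6) by (simp only: int_pow_2[OF assms(3)])
  show "a \<otimes> t = t \<otimes> b" "b \<otimes> t = t \<otimes> a"
    by (rule commute_if_conj; fact assms)+
qed (fact assms)+

lemma wreathed_triple_wreathed_group:
  "wreathed_triple (wreathed_group n)
     (pgen (wreathed_relations n) Wa) (pgen (wreathed_relations n) Wb)
     (pgen (wreathed_relations n) Wt) (2 ^ n)"
proof -
  let ?R = "wreathed_relations n"
  interpret word_valuation "wreathed_group n" "pgen ?R"
    unfolding wreathed_group_def by (rule word_valuation_presented)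
  have rel: "(l, r) \<in> ?R \<Longrightarrow> val l = val r" for l r
    unfolding wreathed_group_def by (rule presented_relation)
  have "(wpow (wgen Wa) (2 ^ n), []) \<in> ?R" "(wpow (wgen Wb) (2 ^ n), []) \<in> ?R"
    "(wpow (wgen Wt) 2, []) \<in> ?R" "(wcomm (wgen Wa) (wgen Wb), []) \<in> ?R"
    "(wconj (wgen Wa) (wgen Wt), wgen Wb) \<in> ?R" "(wconj (wgen Wb) (wgen Wt), wgen Wa) \<in> ?R"
    by (simp_all add: wreathed_relations_def Let_def)
  note eqs = this[THEN rel, unfolded val_simps weval.simps(1)]
  show ?thesis
    by (rule wreathed_tripleI[OF f_closed f_closed f_closed eqs])
qed

lemma wreathed_extension_G_group:
  assumes "odd c"
  shows "wreathed_extension (G_group n p q r s c)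
     (G_gen n p q r s c Ga) (G_gen n p q r s c Gb) (G_gen n p q r s c Gt) (2 ^ n)
     (G_gen n p q r s c Gz) (1 + p) q r s"
proof -
  let ?R = "G_relations n p q r s c"
  let ?G = "G_group n p q r s c"
  interpret word_valuation ?G "pgen ?R"
    unfolding G_group_def by (rule word_valuation_presented)
  have rel: "(l, r) \<in> ?R \<Longrightarrow> val l = val r" for l r
    unfolding G_group_def by (rule presented_relation)
  have "(wpow wa (2 ^ n), []) \<in> ?R" "(wpow wb (2 ^ n), []) \<in> ?R"
    "(wpow wt 2, []) \<in> ?R" "(wcomm wa wb, []) \<in> ?R"
    "(wconj wa wt, wb) \<in> ?R" "(wconj wb wt, wa) \<in> ?R"
    by (simp_all add: G_relations_def Let_def)
  note triple_eqs = this[THEN rel, unfolded val_simps weval.simps(1)]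
  have "(wpow wz 4, []) \<in> ?R" "(wconj wa wz, wpow wa (1 + p) @ wpow wb q) \<in> ?R"
    "(wconj wb wz, wpow wa q @ wpow wb (1 + p)) \<in> ?R"
    "(wconj wt wz, wt @ wpow wz (2 * c) @ wpow wa r @ wpow wb s) \<in> ?R"
    by (simp_all add: G_relations_def Let_def)
  note z_eqs = this[THEN rel, unfolded val_simps weval.simps(1)]
  interpret wreathed_triple ?G "pgen ?R Ga" "pgen ?R Gb" "pgen ?R Gt" "2 ^ n"
    by (rule wreathed_tripleI[OF f_closed f_closed f_closed triple_eqs])
  have "[2 * c = 2] (mod 4)"
  proof -
    obtain d where "c = 2 * d + 1" using \<open>odd c\<close> oddE by blast
    then have "2 * c - 2 = 4 * d" by simp
    then show ?thesis by (simp add: cong_iff_dvd_diff)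
  qed
  from int_pow_cong[OF f_closed z_eqs(1) this]
  have z_2c: "pgen ?R Gz [^]\<^bsub>?G\<^esub> (2 * c) = pgen ?R Gz \<otimes>\<^bsub>?G\<^esub> pgen ?R Gz"
    by (simp only: int_pow_2[OF f_closed])
  have "wreathed_extension ?G (pgen ?R Ga) (pgen ?R Gb) (pgen ?R Gt) (2 ^ n)
     (pgen ?R Gz) (1 + p) q r s"
  proof unfold_locales
    show "pgen ?R Gz \<in> carrier ?G" by (rule f_closed)
    show "pgen ?R Gz [^]\<^bsub>?G\<^esub> (4::int) = \<one>\<^bsub>?G\<^esub>" by (rule z_eqs(1))
    show "pgen ?R Ga \<otimes>\<^bsub>?G\<^esub> pgen ?R Gz = pgen ?R Gz \<otimes>\<^bsub>?G\<^esub> \<beta> (1 + p) q"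
      using z_eqs(2) by (intro commute_if_conj) (simp_all add: \<beta>_def)
    show "pgen ?R Gb \<otimes>\<^bsub>?G\<^esub> pgen ?R Gz = pgen ?R Gz \<otimes>\<^bsub>?G\<^esub> \<beta> q (1 + p)"
      using z_eqs(3) by (intro commute_if_conj) (simp_all add: \<beta>_def)
    show "pgen ?R Gt \<otimes>\<^bsub>?G\<^esub> pgen ?R Gz = pgen ?R Gz \<otimes>\<^bsub>?G\<^esub>
        (pgen ?R Gt \<otimes>\<^bsub>?G\<^esub> (pgen ?R Gz \<otimes>\<^bsub>?G\<^esub> (pgen ?R Gz \<otimes>\<^bsub>?G\<^esub> \<beta> r s)))"
      using z_eqs(4) by (intro commute_if_conj) (simp_all add: z_2c \<beta>_def m_assoc)
  qed
  then show ?thesis by (simp add: G_gen_def)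
qed

lemma generate_G_group:
  "carrier (G_group n p q r s c) = generate (G_group n p q r s c)
     {G_gen n p q r s c Ga, G_gen n p q r s c Gb, G_gen n p q r s c Gt, G_gen n p q r s c Gz}"
proof -
  have "(UNIV :: gen set) = {Ga, Gb, Gt, Gz}"
    using gen.exhaust by blast
  then have "range f = {f Ga, f Gb, f Gt, f Gz}" for f :: "gen \<Rightarrow> gen word set"
    by (metis image_empty image_insert)
  then show ?thesis
    using generate_presented[of "G_relations n p q r s c"]
    by (simp only: G_group_def G_gen_def)
qed

text \<open>
  Read off from the images of two states.  The automorphism \<open>t\<close> fixes \<open>(0, 0, 0)\<close>, the identity of
  \<open>L\<close>, so this state separates everything except the power of \<open>t\<close>; the latter is detected at
  \<open>(1, 0, 0)\<close>, that is at \<open>z\<close>, which \<open>t\<close> inverts modulo \<open>B\<close>.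
\<close>
lemma normal_forms_distinct:
  fixes n :: nat and p q r s c :: int
  assumes data: "extension_data (2 ^ n) (1 + p) q r s" and "odd c"
  defines "G \<equiv> G_group n p q r s c"
  defines "a \<equiv> G_gen n p q r s c Ga" and "b \<equiv> G_gen n p q r s c Gb"
    and "t \<equiv> G_gen n p q r s c Gt" and "z \<equiv> G_gen n p q r s c Gz"
  shows "\<And>x y. wreathed_triple.\<beta> G a b x y = \<one>\<^bsub>G\<^esub> \<Longrightarrow> 2 ^ n dvd x \<and> 2 ^ n dvd y"
    and "t \<notin> wreathed_triple.base G a b"
    and "\<And>k::int. z [^]\<^bsub>G\<^esub> k \<in> generate G {a, b, t} \<Longrightarrow> 4 dvd k"
proof -
  let ?R = "G_relations n p q r s c"
  interpret extension_data "2 ^ n" "1 + p" q r s by (rule data)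
  interpret word_valuation G "pgen ?R"
    unfolding G_def G_group_def by (rule word_valuation_presented)
  interpret wreathed_extension G a b t "2 ^ n" z "1 + p" q r s
    unfolding G_def a_def b_def t_def z_def by (rule wreathed_extension_G_group[OF \<open>odd c\<close>])
  have val: "val u = word_class ?R u" for u
    unfolding G_def G_group_def by (rule weval_presented)
  have gens: "a = val wa" "b = val wb" "t = val wt" "z = val wz"
    by (simp_all only: val a_def b_def t_def z_def G_gen_def)
  have \<beta>: "\<beta> x y = word_class ?R (wpow wa x @ wpow wb y)" for x y
    by (subst val[symmetric]) (simp only: \<beta>_def val_append val_wpow gens[symmetric])
  have t\<beta>: "t \<otimes>\<^bsub>G\<^esub> \<beta> x y = word_class ?R (wt @ wpow wa x @ wpow wb y)" for x y
    by (subst val[symmetric]) (simp only: \<beta>_def val_append val_wpow gens[symmetric])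
  have zk: "z [^]\<^bsub>G\<^esub> k = word_class ?R (wpow wz k)" for k :: int
    by (subst val[symmetric]) (simp only: val_wpow gens[symmetric])
  have act: "eqv (fold act u \<xi>) (fold act w \<xi>)" if "word_class ?R u = word_class ?R w" for u w \<xi>
  proof (rule word_eq_action[OF _ equivp_eqv])
    show "word_eq ?R u w" using that by (simp only: word_class_eq_iff)
    show "eqv (act l \<xi>) (act l \<eta>)" if "eqv \<xi> \<eta>" for l \<xi> \<eta>
      using that by (rule act_resp)
    show "eqv (act (x, \<not> e) (act (x, e) \<xi>)) \<xi>" for x e \<xi>
      by (rule act_cancel)
    show "eqv (fold act l \<xi>) (fold act r' \<xi>)" if "(l, r') \<in> ?R" for l r' \<xi>
      using fold_act_relation[OF _ HOL.refl \<open>odd c\<close>] that by simp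
  qed
  have act_t: "fold act (wt @ u) (0, 0, 0) = fold act u (0, 0, 0)" for u
    by (simp add: wgen_def shift_def)
  note evals = fold_append comp_apply fold_act_a fold_act_b
  show "2 ^ n dvd x \<and> 2 ^ n dvd y" if "\<beta> x y = \<one>\<^bsub>G\<^esub>" for x y
  proof -
    have "word_class ?R (wpow wa x @ wpow wb y) = word_class ?R []"
      using that val[of "[]"] by (simp only: \<beta> weval.simps)
    from act[OF this, of "(0, 0, 0)"] show ?thesis
      by (simp add: evals cong_0_iff)
  qed
  show "t \<notin> base"
  proof
    assume "t \<in> base"
    then obtain x y where "t = \<beta> x y" by (rule baseE)
    then have "word_class ?R wt = word_class ?R (wpow wa x @ wpow wb y)"
      unfolding \<beta> by (simp only: gens val)
    from act[OF this, of "(1, 0, 0)"] have "eqv (fold act wt (1, 0, 0)) (1, x, y)"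
      by (simp add: evals)
    then show False
      by (simp add: wgen_def cong_def)
  qed
  show "4 dvd k" if z_k: "z [^]\<^bsub>G\<^esub> k \<in> generate G {a, b, t}" for k :: int
  proof -
    obtain x y where "z [^]\<^bsub>G\<^esub> k = \<beta> x y \<or> z [^]\<^bsub>G\<^esub> k = t \<otimes>\<^bsub>G\<^esub> \<beta> x y"
      using z_k unfolding generate_abt by (auto elim!: baseE)
    then have "eqv (fold act (wpow wz k) (0, 0, 0)) (0, x, y)"
    proof
      assume "z [^]\<^bsub>G\<^esub> k = \<beta> x y"
      from act[OF this[unfolded zk \<beta>], of "(0, 0, 0)"] show ?thesis by (simp add: evals)
    next
      assume "z [^]\<^bsub>G\<^esub> k = t \<otimes>\<^bsub>G\<^esub> \<beta> x y"
      from act[OF this[unfolded zk t\<beta>], of "(0, 0, 0)"] show ?thesis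
        unfolding act_t by (simp add: evals)
    qed
    moreover have "fst (fold act (wpow wz k) (0, 0, 0)) = k"
      by (simp add: fst_fold_act_z)
    ultimately show ?thesis
      by (cases "fold act (wpow wz k) (0, 0, 0)") (simp add: cong_0_iff)
  qed
qed

abbreviation Wa_gen where "Wa_gen n \<equiv> pgen (wreathed_relations n) Wa"
abbreviation Wb_gen where "Wb_gen n \<equiv> pgen (wreathed_relations n) Wb"
abbreviation Wt_gen where "Wt_gen n \<equiv> pgen (wreathed_relations n) Wt"
abbreviation W_\<beta> where "W_\<beta> n \<equiv> wreathed_triple.\<beta> (wreathed_group n) (Wa_gen n) (Wb_gen n)"

lemma UNIV_wreathed_gen: "UNIV = {Wa, Wb, Wt}"
  using wreathed_gen.exhaust by blast

lemma carrier_wreathed_group: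
  "carrier (wreathed_group n) = generate (wreathed_group n) {Wa_gen n, Wb_gen n, Wt_gen n}"
  using generate_presented[of "wreathed_relations n"]
  by (simp add: wreathed_group_def UNIV_wreathed_gen)

lemma finite_wreathed_group: "finite (carrier (wreathed_group n))"
  unfolding carrier_wreathed_group
  by (rule wreathed_triple.finite_generate_abt[OF wreathed_triple_wreathed_group]) simp

lemma (in wreathed_triple) hom_from_wreathed_group:
  assumes N: "N = 2 ^ n"
  obtains h where "h \<in> hom (wreathed_group n) G"
    and "\<And>x y. h (W_\<beta> n x y) = \<beta> x y" and "h (Wt_gen n) = t"
    and "h ` carrier (wreathed_group n) = generate G {a, b, t}"
proof -
  define f where "f = case_wreathed_gen a b t"
  have f: "f Wa = a" "f Wb = b" "f Wt = t" by (simp_all add: f_def)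
  interpret f: word_valuation G f
    by unfold_locales (simp add: f_def split: wreathed_gen.split)
  have rel: "f.val l = f.val r" if "(l, r) \<in> wreathed_relations n" for l r
  proof -
    have "t [^] (2 :: int) = \<one>" by (simp only: int_pow_2[OF closed(3)] t_t)
    moreover have "inv a \<otimes> (inv b \<otimes> (a \<otimes> b)) = \<one>"
      by (simp add: a_b inv_solve_left')
    moreover have "inv t \<otimes> (a \<otimes> t) = b" "inv t \<otimes> (b \<otimes> t) = a"
      by (simp_all add: a_t b_t)
    ultimately show ?thesis
      using that a_pow_N b_pow_N unfolding wreathed_relations_def Let_def N
      by (elim insertE emptyE Pair_inject) (simp_all only: f.val_simps f weval.simps(1))
  qed
  obtain h where h: "h \<in> hom (presented_group (wreathed_relations n)) G"
    and h_val: "\<And>u. h (word_class (wreathed_relations n) u) = f.val u"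
    using f.von_Dyck[OF rel] by blast
  have hom: "h \<in> hom (wreathed_group n) G" using h by (simp only: wreathed_group_def)
  interpret W: wreathed_triple "wreathed_group n" "Wa_gen n" "Wb_gen n" "Wt_gen n" "2 ^ n"
    by (rule wreathed_triple_wreathed_group)
  interpret h: group_hom "wreathed_group n" G h
    by unfold_locales (rule hom)
  have gens: "h (Wa_gen n) = a" "h (Wb_gen n) = b" "h (Wt_gen n) = t"
    by (simp_all only: h_val f.val_wgen f)
  have "h (W.\<beta> x y) = \<beta> x y" for x y
    by (simp add: W.\<beta>_def \<beta>_def h.hom_int_pow gens)
  moreover have "h ` carrier (wreathed_group n) = generate G {a, b, t}"
    unfolding carrier_wreathed_group
    using h.generate_img[of "{Wa_gen n, Wb_gen n, Wt_gen n}"] by (simp add: gens)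
  ultimately show ?thesis using hom gens(3) that by blast
qed

text \<open>
  The wreathed group maps to the group \<open>G\<close> with \<open>Z = I\<close> and \<open>v = 0\<close>, where normal forms are known to
  be distinct.
\<close>
lemma wreathed_base_faithful:
  assumes "W_\<beta> n x y = \<one>\<^bsub>wreathed_group n\<^esub>"
  shows "2 ^ n dvd x \<and> 2 ^ n dvd y"
proof -
  have data: "extension_data (2 ^ n) (1 + 0) 0 0 0"
    by unfold_locales simp_all
  interpret wreathed_extension "G_group n 0 0 0 0 1" "G_gen n 0 0 0 0 1 Ga" "G_gen n 0 0 0 0 1 Gb"
    "G_gen n 0 0 0 0 1 Gt" "2 ^ n" "G_gen n 0 0 0 0 1 Gz" "1 + 0" 0 0 0
    by (rule wreathed_extension_G_group) simp
  interpret W: wreathed_triple "wreathed_group n" "Wa_gen n" "Wb_gen n" "Wt_gen n" "2 ^ n"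
    by (rule wreathed_triple_wreathed_group)
  obtain h where h: "h \<in> hom (wreathed_group n) (G_group n 0 0 0 0 1)"
    and h_\<beta>: "\<And>x y. h (W_\<beta> n x y) = \<beta> x y"
    by (rule hom_from_wreathed_group[OF HOL.refl]) (rule that)
  have "\<beta> x y = h (W_\<beta> n x y)" by (rule h_\<beta>[symmetric])
  also have "\<dots> = \<one>\<^bsub>G_group n 0 0 0 0 1\<^esub>"
    unfolding assms by (rule hom_one[OF h W.is_group is_group])
  finally have "\<beta> x y = \<one>\<^bsub>G_group n 0 0 0 0 1\<^esub>" .
  then show ?thesis
    by (rule normal_forms_distinct(1)[OF data odd_one])
qed

context wreathed_triple
begin

text \<open>
  An arbitrary isomorphism need not match the generators.  It still shows that \<open>H\<close> is finite with as
  many elements as the wreathed group, and so the canonical surjection, which does match the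
  generators, is injective.
\<close>
lemma faithful_if_wreathed:
  assumes N: "N = 2 ^ n" and iso: "G\<lparr>carrier := generate G {a, b, t}\<rparr> \<cong> wreathed_group n"
    and \<beta>: "\<beta> x y = \<one>"
  shows "N dvd x \<and> N dvd y"
proof -
  interpret W: wreathed_triple "wreathed_group n" "Wa_gen n" "Wb_gen n" "Wt_gen n" "2 ^ n"
    by (rule wreathed_triple_wreathed_group)
  obtain h where h: "h \<in> hom (wreathed_group n) G" "\<And>x y. h (W_\<beta> n x y) = \<beta> x y"
    and img: "h ` carrier (wreathed_group n) = generate G {a, b, t}"
    by (rule hom_from_wreathed_group[OF N]) (rule that)
  have "card (h ` carrier (wreathed_group n)) = card (carrier (wreathed_group n))"
  proof -
    obtain \<phi> where "bij_betw \<phi> (generate G {a, b, t}) (carrier (wreathed_group n))"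
      using iso unfolding is_iso_def iso_def by auto
    then show ?thesis unfolding img by (rule bij_betw_same_card)
  qed
  then have inj: "inj_on h (carrier (wreathed_group n))"
    by (rule eq_card_imp_inj_on[OF finite_wreathed_group])
  have "h (W_\<beta> n x y) = h \<one>\<^bsub>wreathed_group n\<^esub>"
    using \<beta> h(2) hom_one[OF h(1) W.is_group is_group] by simp
  then have "W_\<beta> n x y = \<one>\<^bsub>wreathed_group n\<^esub>"
    by (rule inj_onD[OF inj]) simp_all
  then show ?thesis
    unfolding N by (rule wreathed_base_faithful)
qed

lemma wreathed_if_faithful:
  assumes N: "N = 2 ^ n" and faithful: "\<And>x y. \<beta> x y = \<one> \<Longrightarrow> N dvd x \<and> N dvd y"
    and t: "t \<notin> base"
  shows "G\<lparr>carrier := generate G {a, b, t}\<rparr> \<cong> wreathed_group n"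
proof -
  interpret W: wreathed_triple "wreathed_group n" "Wa_gen n" "Wb_gen n" "Wt_gen n" "2 ^ n"
    by (rule wreathed_triple_wreathed_group)
  obtain h where h: "h \<in> hom (wreathed_group n) G" "\<And>x y. h (W_\<beta> n x y) = \<beta> x y"
    "h (Wt_gen n) = t"
    and img: "h ` carrier (wreathed_group n) = generate G {a, b, t}"
    by (rule hom_from_wreathed_group[OF N]) (rule that)
  interpret h: group_hom "wreathed_group n" G h
    by unfold_locales (rule h(1))
  have "g = \<one>\<^bsub>wreathed_group n\<^esub>" if g: "g \<in> carrier (wreathed_group n)" "h g = \<one>" for g
  proof -
    have "g \<in> W.base \<or> g \<in> (\<lambda>g. Wt_gen n \<otimes>\<^bsub>wreathed_group n\<^esub> g) ` W.base"
      using g(1) unfolding carrier_wreathed_group W.generate_abt by blast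
    then show ?thesis
    proof
      assume "g \<in> W.base"
      then obtain x y where g_eq: "g = W.\<beta> x y" by (rule W.baseE)
      then have "N dvd x \<and> N dvd y" using faithful g(2) h(2) by simp
      then have "W.\<beta> x y = W.\<beta> 0 0"
        by (intro W.\<beta>_cong) (simp_all add: cong_0_iff N)
      then show ?thesis by (simp add: g_eq)
    next
      assume "g \<in> (\<lambda>g. Wt_gen n \<otimes>\<^bsub>wreathed_group n\<^esub> g) ` W.base"
      then obtain x y where "g = Wt_gen n \<otimes>\<^bsub>wreathed_group n\<^esub> W.\<beta> x y"
        by (auto elim!: W.baseE)
      then have "t \<otimes> \<beta> x y = \<one>" using g(2) h(2,3) by simp
      then have "t = inv (\<beta> x y)"
        using inv_equality[of t "\<beta> x y"] by simp
      then have "t \<in> base" by (simp add: \<beta>_inv)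
      with t show ?thesis by blast
    qed
  qed
  then have "inj_on h (carrier (wreathed_group n))"
    by (subst h.inj_on_one_iff) blast
  moreover have "h \<in> hom (wreathed_group n) (G\<lparr>carrier := generate G {a, b, t}\<rparr>)"
    using h(1) img by (auto simp: hom_def)
  ultimately have "h \<in> iso (wreathed_group n) (G\<lparr>carrier := generate G {a, b, t}\<rparr>)"
    using img by (auto simp: iso_def bij_betw_def)
  then show ?thesis
    using group.iso_sym[OF W.is_group is_isoI] by blast
qed

end

section \<open>Reduction to congruences\<close>

lemma mat_cong_Z_Z_iff:
  "mat_cong (Z_mat p q ** Z_mat p q) (mat 1) m \<longleftrightarrow>
   [(1 + p) * (1 + p) + q * q = 1] (mod m) \<and> [2 * (1 + p) * q = 0] (mod m)"
proof -
  have "mat_cong (Z_mat p q ** Z_mat p q) (mat 1) m \<longleftrightarrow>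
    ([(1 + p) * (1 + p) + q * q = 1] (mod m) \<and> [(1 + p) * q + q * (1 + p) = 0] (mod m)) \<and>
    ([q * (1 + p) + (1 + p) * q = 0] (mod m) \<and> [q * q + (1 + p) * (1 + p) = 1] (mod m))"
    by (simp add: mat_cong_def Z_mat_def matrix_matrix_mult_def mat_def forall_2 sum_2)
  moreover have "(1 + p) * q + q * (1 + p) = 2 * (1 + p) * q"
    "q * (1 + p) + (1 + p) * q = 2 * (1 + p) * q"
    "q * q + (1 + p) * (1 + p) = (1 + p) * (1 + p) + q * q"
    by (simp_all add: algebra_simps)
  ultimately show ?thesis by (simp only:) blast
qed

lemma vec_cong_Z_J_iff:
  "vec_cong ((Z_mat p q - J_mat) *v vector [r, s]) 0 m \<longleftrightarrow>
   [(1 + p) * r + q * s = s] (mod m) \<and> [q * r + (1 + p) * s = r] (mod m)"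
  by (simp add: vec_cong_def Z_mat_def J_mat_def matrix_vector_mult_def forall_2 sum_2
      cong_iff_dvd_diff algebra_simps)

lemma vec_cong_I_Z_iff:
  assumes "even m"
  shows "vec_cong ((mat 1 + Z_mat p q) *v vector [r, s]) 0 (m div 2) \<longleftrightarrow>
   [2 * (r + ((1 + p) * r + q * s)) = 0] (mod m) \<and> [2 * (s + (q * r + (1 + p) * s)) = 0] (mod m)"
proof -
  obtain k where m: "m = 2 * k" using assms by blast
  have double: "[2 * x = 0] (mod m) \<longleftrightarrow> [x = 0] (mod m div 2)" for x
    by (simp add: m cong_0_iff)
  show ?thesis
    unfolding double
    by (simp add: vec_cong_def Z_mat_def mat_def matrix_vector_mult_def forall_2 sum_2 algebra_simps)
qed

lemma extension_data_iff:
  "extension_data m P q r s \<longleftrightarrow>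
   ([P * P + q * q = 1] (mod m) \<and> [2 * P * q = 0] (mod m)) \<and>
   ([P * r + q * s = s] (mod m) \<and> [q * r + P * s = r] (mod m)) \<and>
   ([2 * (r + (P * r + q * s)) = 0] (mod m) \<and> [2 * (s + (q * r + P * s)) = 0] (mod m))"
proof -
  have "[2 * (r + (P * r + q * s)) = 2 * (r + s)] (mod m)"
    "[2 * (s + (q * r + P * s)) = 2 * (s + r)] (mod m)"
    if "[P * r + q * s = s] (mod m)" "[q * r + P * s = r] (mod m)"
    by (intro cong_scalar_left cong_add cong_refl that)+
  then show ?thesis
    unfolding extension_data_def by (auto simp: add.commute intro: cong_trans cong_sym)
qed

text \<open>
  Doubling the modulus is possible because \<open>(y + m k)\<^sup>2 = y\<^sup>2 + 2 m k y + m\<^sup>2 k\<^sup>2\<close> and \<open>2 m\<close> divides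
  \<open>m\<^sup>2\<close> for even \<open>m\<close>.
\<close>
lemma square_cong_double:
  fixes x y m :: int
  assumes "[x = y] (mod m)" "even m"
  shows "[x\<^sup>2 = y\<^sup>2] (mod 2 * m)"
proof -
  obtain k where x: "x = y + m * k" using assms(1) by (metis cong_iff_lin cong_sym)
  obtain j where m: "m = 2 * j" using assms(2) by blast
  have "x\<^sup>2 - y\<^sup>2 = 2 * m * (y * k + j * k\<^sup>2)"
    by (simp add: x m power2_eq_square algebra_simps)
  then show ?thesis by (simp add: cong_iff_dvd_diff)
qed

text \<open>
  From \<open>(P + q)\<^sup>2 + (P - q)\<^sup>2 = 2 (P\<^sup>2 + q\<^sup>2)\<close> and \<open>(P + q)\<^sup>2 - (P - q)\<^sup>2 = 2 (2 P q)\<close>; the common factor 2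
  cancels against the modulus.
\<close>
lemma involution_iff_eigenvalues:
  fixes P q \<sigma> \<mu> m :: int
  assumes \<sigma>: "[\<sigma> = P + q] (mod m)" and \<mu>: "[\<mu> = P - q] (mod m)" and m: "even m"
  shows "[P * P + q * q = 1] (mod m) \<and> [2 * P * q = 0] (mod m) \<longleftrightarrow>
    [\<sigma>\<^sup>2 + \<mu>\<^sup>2 = 2] (mod 2 * m) \<and> [\<sigma>\<^sup>2 = \<mu>\<^sup>2] (mod 2 * m)"
proof -
  have \<sigma>2: "[\<sigma>\<^sup>2 = (P + q)\<^sup>2] (mod 2 * m)" and \<mu>2: "[\<mu>\<^sup>2 = (P - q)\<^sup>2] (mod 2 * m)"
    using square_cong_double[OF \<sigma> m] square_cong_double[OF \<mu> m] by simp_all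
  have "[\<sigma>\<^sup>2 + \<mu>\<^sup>2 = 2] (mod 2 * m) \<longleftrightarrow> [(P + q)\<^sup>2 + (P - q)\<^sup>2 = 2] (mod 2 * m)"
    using cong_add[OF \<sigma>2 \<mu>2] by (simp only: cong_def)
  also have "\<dots> \<longleftrightarrow> 2 * m dvd 2 * (P * P + q * q - 1)"
    by (simp add: cong_iff_dvd_diff power2_eq_square algebra_simps)
  also have "\<dots> \<longleftrightarrow> [P * P + q * q = 1] (mod m)"
    by (simp only: dvd_times_left_cancel_iff cong_iff_dvd_diff)
  finally have 1: "[\<sigma>\<^sup>2 + \<mu>\<^sup>2 = 2] (mod 2 * m) \<longleftrightarrow> [P * P + q * q = 1] (mod m)" .
  have "[\<sigma>\<^sup>2 = \<mu>\<^sup>2] (mod 2 * m) \<longleftrightarrow> [(P + q)\<^sup>2 = (P - q)\<^sup>2] (mod 2 * m)"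
    using \<sigma>2 \<mu>2 by (simp only: cong_def)
  also have "\<dots> \<longleftrightarrow> 2 * m dvd 2 * (2 * P * q)"
    by (simp add: cong_iff_dvd_diff power2_eq_square algebra_simps)
  also have "\<dots> \<longleftrightarrow> [2 * P * q = 0] (mod m)"
    by (simp only: dvd_times_left_cancel_iff cong_0_iff)
  finally show ?thesis using 1 by simp
qed

lemma fourth_power_if_involution:
  fixes P q \<sigma> m :: int
  assumes "[P * P + q * q = 1] (mod m)" "[2 * P * q = 0] (mod m)" and \<sigma>: "[\<sigma> = P + q] (mod m)"
  shows "[\<sigma> ^ 4 = 1] (mod m)"
proof -
  have "[(P + q)\<^sup>2 = 1] (mod m)"
    using cong_add[OF assms(1,2)] by (simp add: power2_eq_square algebra_simps)
  then have "[\<sigma>\<^sup>2 = 1] (mod m)"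
    using cong_pow[OF \<sigma>, of 2] by (rule cong_trans[rotated])
  from cong_pow[OF this, of 2] show ?thesis by (simp flip: power_mult)
qed

text \<open>
  Forward: \<open>H \<cong> W\<close> makes \<open>B\<close> a full copy of \<open>(\<int> / N)\<^sup>2\<close>, and the identities in \<open>B\<close> forced by the
  relations become congruences.  Backward: the action on \<open>L\<close> keeps the normal forms apart.
\<close>
lemma presented_group_iff:
  fixes n :: nat and p q r s c :: int
  assumes "odd c"
  defines "G \<equiv> G_group n p q r s c"
  defines "a \<equiv> G_gen n p q r s c Ga" and "b \<equiv> G_gen n p q r s c Gb"
    and "t \<equiv> G_gen n p q r s c Gt" and "z \<equiv> G_gen n p q r s c Gz"
  defines "H \<equiv> generate G {a, b, t}" and "K \<equiv> generate G {z}" and "B \<equiv> generate G {a, b}"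
  shows "nonsplit_exact_product G H K \<and> G\<lparr>carrier := H\<rparr> \<cong> wreathed_group n \<and>
      G\<lparr>carrier := K\<rparr> \<cong> integer_mod_group 4 \<and> B \<lhd> G \<longleftrightarrow>
    extension_data (2 ^ n) (1 + p) q r s"
proof -
  interpret wreathed_extension G a b t "2 ^ n" z "1 + p" q r s
    unfolding G_def a_def b_def t_def z_def by (rule wreathed_extension_G_group[OF \<open>odd c\<close>])
  have gen: "carrier G = generate G {a, b, t, z}"
    unfolding G_def a_def b_def t_def z_def by (rule generate_G_group)
  show ?thesis
  proof
    assume "nonsplit_exact_product G H K \<and> G\<lparr>carrier := H\<rparr> \<cong> wreathed_group n \<and>
      G\<lparr>carrier := K\<rparr> \<cong> integer_mod_group 4 \<and> B \<lhd> G"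
    then have "G\<lparr>carrier := generate G {a, b, t}\<rparr> \<cong> wreathed_group n"
      by (simp add: H_def)
    note conditions_if_faithful[OF faithful_if_wreathed[OF HOL.refl this]]
    then show "extension_data (2 ^ n) (1 + p) q r s"
      unfolding extension_data_iff by blast
  next
    assume data: "extension_data (2 ^ n) (1 + p) q r s"
    note distinct = normal_forms_distinct[OF data \<open>odd c\<close>,
        folded G_def a_def b_def t_def z_def]
    show "nonsplit_exact_product G H K \<and> G\<lparr>carrier := H\<rparr> \<cong> wreathed_group n \<and>
      G\<lparr>carrier := K\<rparr> \<cong> integer_mod_group 4 \<and> B \<lhd> G"
      unfolding H_def K_def B_def generate_ab
      using nonsplit_if_z_free[OF gen distinct(3)] K_cyclic_if_z_free[OF distinct(3)]
        wreathed_if_faithful[OF HOL.refl distinct(1,2)] base_normal[OF gen] by blast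
  qed
qed

theorem theorem6p2:
  fixes n :: nat and N p q r s c \<sigma> \<mu> :: int
    and Z J I :: "int ^ 2 ^ 2" and v :: "int ^ 2"
    and G :: "gen word set monoid" and a b t z :: "gen word set"
    and H K B :: "gen word set set"
  assumes "n \<ge> 1" and "N = 2 ^ n" and "odd c"
    and "Z = Z_mat p q" and "J = J_mat" and "I = mat 1" and "v = vector [r, s]"
    and "[\<sigma> = 1 + p + q] (mod N)" and "[\<mu> = 1 + p - q] (mod N)"
    and "G = G_group n p q r s c"
    and "a = G_gen n p q r s c Ga" and "b = G_gen n p q r s c Gb"
    and "t = G_gen n p q r s c Gt" and "z = G_gen n p q r s c Gz"
    and "H = generate G {a, b, t}" and "K = generate G {z}" and "B = generate G {a, b}"
  shows
    "((nonsplit_exact_product G H K \<and>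
      G\<lparr>carrier := H\<rparr> \<cong> wreathed_group n \<and>
      G\<lparr>carrier := K\<rparr> \<cong> integer_mod_group 4 \<and>
      B \<lhd> G)
     \<longleftrightarrow>
     (mat_cong (Z ** Z) I N \<and>
      vec_cong ((Z - J) *v v) 0 N \<and>
      vec_cong ((I + Z) *v v) 0 (N div 2)))
     \<and>
     (mat_cong (Z ** Z) I N \<longleftrightarrow>
      [\<sigma>\<^sup>2 + \<mu>\<^sup>2 = 2] (mod 2 * N) \<and> [\<sigma>\<^sup>2 = \<mu>\<^sup>2] (mod 2 * N))
     \<and>
     (mat_cong (Z ** Z) I N \<longrightarrow> [\<sigma> ^ 4 = 1] (mod N) \<and> [\<mu> ^ 4 = 1] (mod N))
     \<and>
     (\<exists>(n'::nat) (p'::int) (q'::int). n' \<ge> 1 \<and>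
      [(1 + p' + q') ^ 4 = 1] (mod 2 ^ n') \<and> [(1 + p' - q') ^ 4 = 1] (mod 2 ^ n') \<and>
      \<not> mat_cong (Z_mat p' q' ** Z_mat p' q') (mat 1) (2 ^ n'))"
proof -
  have N: "even N" using \<open>n \<ge> 1\<close> by (simp add: \<open>N = 2 ^ n\<close>)
  have Z_Z: "mat_cong (Z ** Z) I N \<longleftrightarrow>
      [(1 + p) * (1 + p) + q * q = 1] (mod N) \<and> [2 * (1 + p) * q = 0] (mod N)"
    unfolding \<open>Z = Z_mat p q\<close> \<open>I = mat 1\<close> by (rule mat_cong_Z_Z_iff)
  have conditions: "mat_cong (Z ** Z) I N \<and> vec_cong ((Z - J) *v v) 0 N \<and>
      vec_cong ((I + Z) *v v) 0 (N div 2) \<longleftrightarrow> extension_data (2 ^ n) (1 + p) q r s"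
    unfolding Z_Z unfolding \<open>Z = Z_mat p q\<close> \<open>J = J_mat\<close> \<open>I = mat 1\<close> \<open>v = vector [r, s]\<close>
      vec_cong_Z_J_iff vec_cong_I_Z_iff[OF N] extension_data_iff unfolding \<open>N = 2 ^ n\<close> by (rule HOL.refl)
  have group: "nonsplit_exact_product G H K \<and> G\<lparr>carrier := H\<rparr> \<cong> wreathed_group n \<and>
      G\<lparr>carrier := K\<rparr> \<cong> integer_mod_group 4 \<and> B \<lhd> G \<longleftrightarrow>
      mat_cong (Z ** Z) I N \<and> vec_cong ((Z - J) *v v) 0 N \<and> vec_cong ((I + Z) *v v) 0 (N div 2)"
    unfolding conditions assms(10-17) by (rule presented_group_iff[OF \<open>odd c\<close>])
  have eigenvalues: "mat_cong (Z ** Z) I N \<longleftrightarrow>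
      [\<sigma>\<^sup>2 + \<mu>\<^sup>2 = 2] (mod 2 * N) \<and> [\<sigma>\<^sup>2 = \<mu>\<^sup>2] (mod 2 * N)"
    unfolding Z_Z by (rule involution_iff_eigenvalues[OF assms(8,9) N])
  have fourth: "[\<sigma> ^ 4 = 1] (mod N) \<and> [\<mu> ^ 4 = 1] (mod N)" if "mat_cong (Z ** Z) I N"
  proof
    have Z: "[(1 + p) * (1 + p) + q * q = 1] (mod N)" "[2 * (1 + p) * q = 0] (mod N)"
      using that by (simp_all only: Z_Z)
    show "[\<sigma> ^ 4 = 1] (mod N)"
      by (rule fourth_power_if_involution[OF Z assms(8)])
    have "[2 * (1 + p) * (- q) = 0] (mod N)"
      using Z(2) by (simp add: cong_0_iff)
    then show "[\<mu> ^ 4 = 1] (mod N)"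
      using Z(1) assms(9) fourth_power_if_involution[of "1 + p" "- q" N \<mu>] by simp
  qed
  \<comment> \<open>With \<open>N = 16\<close> and \<open>Z = 3 I\<close>: \<open>3 ^ 4 = 81\<close> is \<open>1\<close> modulo 16, while \<open>Z\<^sup>2 = 9 I\<close>.\<close>
  have "[(1 + 2 + 0) ^ 4 = (1 :: int)] (mod 2 ^ 4)" "[(1 + 2 - 0) ^ 4 = (1 :: int)] (mod 2 ^ 4)"
    "\<not> mat_cong (Z_mat 2 0 ** Z_mat 2 0) (mat 1) (2 ^ 4)"
    unfolding mat_cong_Z_Z_iff by (simp_all add: cong_def)
  then have strict: "\<exists>(n'::nat) (p'::int) (q'::int). n' \<ge> 1 \<and>
      [(1 + p' + q') ^ 4 = 1] (mod 2 ^ n') \<and> [(1 + p' - q') ^ 4 = 1] (mod 2 ^ n') \<and>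
      \<not> mat_cong (Z_mat p' q' ** Z_mat p' q') (mat 1) (2 ^ n')"
    by (intro exI[of _ 4] exI[of _ 2] exI[of _ 0]) simp
  from group eigenvalues fourth strict show ?thesis by blast
qed

end
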